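(* Let $K$ be a commutative ring and $n\ge4$. Then: 1. $\Gamma_{2s}=\Gamma^{2s+1}\Sigma=\Phi^{2s+1}\Sigma=\Phi'^{2s+1}\Sigma$ for each $s=1,2,\dots,\left[\frac{n-1}2\right]$. 2. If $n$ is an even number then $\Gamma_n=\Sigma$, i.e. $\Gamma_n=\Gamma_{n+2}=\Sigma$.
   Context: $\Lambda_n=\Lambda_n(K)$ is the Grassmann $K$-algebra generated freely over $K$ by $x_1,\dots,x_n$ subject to $x_i^2=0$, $x_ix_j=-x_jx_i$ ($i\ne j$); it is free over $K$ with basis $x^\alpha=x_{i_1}\cdots x_{i_k}$, $\alpha=\{i_1<\dots<i_k\}\subseteq\{1,\dots,n\}$, graded by $|\alpha|$, with components $\Lambda_{n,d}$; $\mathfrak m=\bigoplus_{d\ge1}\Lambda_{n,d}$; $\Lambda_n^{od}$ is the sum of the odd degree components. $K\lfloor x_1,\dots,\widehat{x_i},\dots,x_n\rfloor$ is the subalgebra generated by the $x_j$, $j\ne i$. $\Gamma$ is the group of $K$-algebra automorphisms $\sigma$ of $\Lambda_n$ with $\sigma(x_i)-x_i\in\Lambda_n^{od}\cap\mathfrak m^3$ for all $i$, and $\Gamma^{2s+1}=\{\sigma\in\Gamma\mid\sigma(x_i)-x_i\in\Lambda_n^{od}\cap\mathfrak m^{2s+1}\text{ for all }i\}$. The left skew derivation $\partial/\partial x_j$ is the $K$-linear map with $\frac{\partial x_k}{\partial x_j}=\delta_{jk}$ and $\frac{\partial (ab)}{\partial x_j}=\frac{\partial a}{\partial x_j}b+(-1)^i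 a\frac{\partial b}{\partial x_j}$ for $a\in\Lambda_{n,i}$. For $\sigma\in\Gamma$, $\mathcal J(\sigma)=\det(\partial\sigma(x_i)/\partial x_j)$ (entries are even, hence central). $E_n'=1+\sum_{m\ge1}\Lambda_{n,2m}$ and $E'_{n,2m}=E_n'\cap(1+\mathfrak m^{2m})$. The Jacobian group is $\Sigma=\{\sigma\in\Gamma\mid\mathcal J(\sigma)=1\}$ and the Jacobian ascents are the subgroups $\Gamma_{2m}=\{\sigma\in\Gamma\mid\mathcal J(\sigma)\in E'_{n,2m}\}$. $\Phi$ is the subgroup of $\Gamma$ of all $\sigma$ with $\sigma(x_i)=x_i(1+c_i)$ for all $i$, where $c_i\in K\lfloor x_1,\dots,\widehat{x_i},\dots,x_n\rfloor$ has only components of even degree $\ge2$. $\Phi^{2s+1}=\Phi\cap\Gamma^{2s+1}$. $\Phi'^{2s+1}$ is the subgroup of those $\sigma\in\Phi^{2s+1}$, $\sigma(x_i)=x_i(1+c_i)$, for which the degree $2s$ component of each $c_i$ lies in the $K$-span $A_i$ of all monomials $x^\alpha$ with $|\alpha|=2s$, $i\notin\alpha$, $\{i+1,\dots,n\}\subseteq\alpha$ (so $A_i=0$ for $i<n-2s$). For subgroups $A,B$ of $\Gamma$, $AB=\{ab\mid a\in A,b\in B\}$. *)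

theory Defs
  imports Complex_Main "HOL-Library.Cardinality" "HOL-Combinatorics.Permutations"
begin

section \<open>The Grassmann algebra\<close>

text \<open>
  The generators are indexed by a finite linearly ordered type \<open>'n\<close>, which stands for
  \<open>{1 < \<dots> < n}\<close> with \<open>n = CARD('n)\<close>. An element of \<open>\<Lambda>\<^sub>n(K)\<close> is given by its coefficients with
  respect to the basis \<open>x\<^sup>\<alpha>\<close>, \<open>\<alpha>\<close> a subset of the index type.
\<close>

typedef ('a, 'n) grassmann = "UNIV :: ('n set \<Rightarrow> 'a) set"
  morphisms coeff Grassmann
  by simp

setup_lifting type_definition_grassmann

lemma grassmann_eqI: "(\<And>\<alpha>. coeff a \<alpha> = coeff b \<alpha>) \<Longrightarrow> a = b"
  by transfer auto

text \<open>
  For disjoint \<open>\<alpha>\<close> and \<open>\<beta>\<close> one has \<open>x\<^sup>\<alpha> x\<^sup>\<beta> = koszul_sign \<alpha> \<beta> x\<^bsup>\<alpha> \<union> \<beta>\<^esup>\<close>: each pair of indices that is out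
  of order costs one transposition.
\<close>

definition koszul_sign :: "'n::linorder set \<Rightarrow> 'n set \<Rightarrow> 'a::comm_ring_1" where
  "koszul_sign \<alpha> \<beta> = (\<Prod>i\<in>\<alpha>. \<Prod>j\<in>\<beta>. if j < i then - 1 else 1)"

lemma koszul_sign_empty [simp]: "koszul_sign {} \<beta> = 1" "koszul_sign \<alpha> {} = 1"
  by (simp_all add: koszul_sign_def)

lemma koszul_sign_Un_left:
  fixes \<alpha> :: "'n::{finite,linorder} set"
  shows "\<alpha> \<inter> \<beta> = {} \<Longrightarrow> koszul_sign (\<alpha> \<union> \<beta>) \<gamma> = koszul_sign \<alpha> \<gamma> * koszul_sign \<beta> \<gamma>"
  unfolding koszul_sign_def by (rule prod.union_disjoint) auto

lemma koszul_sign_Un_right: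
  fixes \<alpha> :: "'n::{finite,linorder} set"
  shows "\<beta> \<inter> \<gamma> = {} \<Longrightarrow> koszul_sign \<alpha> (\<beta> \<union> \<gamma>) = koszul_sign \<alpha> \<beta> * koszul_sign \<alpha> \<gamma>"
  unfolding koszul_sign_def by (simp add: prod.union_disjoint prod.distrib)

lemma koszul_sign_square [simp]: "koszul_sign \<alpha> \<beta> * koszul_sign \<alpha> \<beta> = 1"
  unfolding koszul_sign_def prod.distrib [symmetric] by (intro prod.neutral ballI) auto

lemma koszul_sign_swap:
  fixes \<alpha> :: "'n::{finite,linorder} set"
  assumes "j \<notin> \<alpha>"
  shows "koszul_sign \<alpha> {j} * koszul_sign {j} \<alpha> = (- 1) ^ card \<alpha>"
proof -
  have "koszul_sign \<alpha> {j} * koszul_sign {j} \<alpha>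
      = (\<Prod>i\<in>\<alpha>. (if j < i then - 1 else 1) * (if i < j then - 1 else 1))"
    by (simp add: koszul_sign_def prod.distrib)
  also have "\<dots> = (\<Prod>i\<in>\<alpha>. - 1)"
    using assms by (intro prod.cong) (auto simp: not_less_iff_gr_or_eq)
  finally show ?thesis by simp
qed

instantiation grassmann :: (comm_ring_1, "{finite,linorder}") ring_1
begin

lift_definition zero_grassmann :: "('a, 'b) grassmann" is "\<lambda>_. 0" .
lift_definition one_grassmann :: "('a, 'b) grassmann" is "\<lambda>\<alpha>. if \<alpha> = {} then 1 else 0" .
lift_definition plus_grassmann :: "('a, 'b) grassmann \<Rightarrow> ('a, 'b) grassmann \<Rightarrow> ('a, 'b) grassmann"
  is "\<lambda>a b \<alpha>. a \<alpha> + b \<alpha>" .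
lift_definition uminus_grassmann :: "('a, 'b) grassmann \<Rightarrow> ('a, 'b) grassmann"
  is "\<lambda>a \<alpha>. - a \<alpha>" .
lift_definition minus_grassmann :: "('a, 'b) grassmann \<Rightarrow> ('a, 'b) grassmann \<Rightarrow> ('a, 'b) grassmann"
  is "\<lambda>a b \<alpha>. a \<alpha> - b \<alpha>" .
lift_definition times_grassmann :: "('a, 'b) grassmann \<Rightarrow> ('a, 'b) grassmann \<Rightarrow> ('a, 'b) grassmann"
  is "\<lambda>a b \<gamma>. \<Sum>\<alpha>\<in>Pow \<gamma>. koszul_sign \<alpha> (\<gamma> - \<alpha>) * a \<alpha> * b (\<gamma> - \<alpha>)" .

instance
proof
  fix a b c :: "('a, 'b) grassmann"
  show "a * b * c = a * (b * c)"
  proof (rule grassmann_eqI)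
    fix \<gamma>
    let ?t = "\<lambda>\<alpha> \<beta>. koszul_sign \<alpha> (\<gamma> - \<alpha>) * koszul_sign \<beta> (\<gamma> - \<alpha> - \<beta>)
      * coeff a \<alpha> * coeff b \<beta> * coeff c (\<gamma> - \<alpha> - \<beta>) :: 'a"
    have "coeff (a * b * c) \<gamma> = (\<Sum>(\<delta>, \<alpha>)\<in>(SIGMA \<delta>:Pow \<gamma>. Pow \<delta>).
        koszul_sign \<delta> (\<gamma> - \<delta>) * koszul_sign \<alpha> (\<delta> - \<alpha>)
          * coeff a \<alpha> * coeff b (\<delta> - \<alpha>) * coeff c (\<gamma> - \<delta>))"
      by (simp add: times_grassmann.rep_eq sum_distrib_left sum_distrib_right sum.Sigma mult.assoc)
    also have "\<dots> = (\<Sum>(\<alpha>, \<beta>)\<in>(SIGMA \<alpha>:Pow \<gamma>. Pow (\<gamma> - \<alpha>)). ?t \<alpha> \<beta>)"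
    proof (rule sum.reindex_bij_witness
        [where i = "\<lambda>(\<alpha>, \<beta>). (\<alpha> \<union> \<beta>, \<alpha>)" and j = "\<lambda>(\<delta>, \<alpha>). (\<alpha>, \<delta> - \<alpha>)"], goal_cases)
      case (5 p)
      obtain \<delta> \<alpha> where p: "p = (\<delta>, \<alpha>)" by (cases p)
      with 5 have sub: "\<alpha> \<subseteq> \<delta>" "\<delta> \<subseteq> \<gamma>" by auto
      define \<beta> \<epsilon> where "\<beta> = \<delta> - \<alpha>" and "\<epsilon> = \<gamma> - \<delta>"
      have eqs: "\<delta> = \<alpha> \<union> \<beta>" "\<gamma> - \<alpha> = \<beta> \<union> \<epsilon>" "\<gamma> - \<alpha> - \<beta> = \<epsilon>" "\<alpha> \<inter> \<beta> = {}" "\<beta> \<inter> \<epsilon> = {}"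
        using sub by (auto simp: \<beta>_def \<epsilon>_def)
      have "koszul_sign \<delta> \<epsilon> * koszul_sign \<alpha> \<beta>
          = (koszul_sign \<alpha> (\<gamma> - \<alpha>) * koszul_sign \<beta> \<epsilon> :: 'a)"
        unfolding eqs(1,2) by (simp add: koszul_sign_Un_left koszul_sign_Un_right eqs(4,5) mult_ac)
      then show ?case
        unfolding p by (simp add: eqs(3) \<beta>_def [symmetric] \<epsilon>_def [symmetric])
    qed auto
    also have "\<dots> = coeff (a * (b * c)) \<gamma>"
      by (simp add: times_grassmann.rep_eq sum_distrib_left sum.Sigma [symmetric] mult_ac)
    finally show "coeff (a * b * c) \<gamma> = coeff (a * (b * c)) \<gamma>" .
  qed
  show "1 * a = a"
  proof (rule grassmann_eqI)
    fix \<gamma>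
    have "coeff (1 * a) \<gamma> = (\<Sum>\<alpha>\<in>Pow \<gamma>. if \<alpha> = {} then coeff a \<gamma> else 0)"
      unfolding times_grassmann.rep_eq one_grassmann.rep_eq by (intro sum.cong) auto
    then show "coeff (1 * a) \<gamma> = coeff a \<gamma>" by simp
  qed
  show "a * 1 = a"
  proof (rule grassmann_eqI)
    fix \<gamma>
    have "coeff (a * 1) \<gamma> = (\<Sum>\<alpha>\<in>Pow \<gamma>. if \<alpha> = \<gamma> then coeff a \<gamma> else 0)"
      unfolding times_grassmann.rep_eq one_grassmann.rep_eq by (intro sum.cong) auto
    then show "coeff (a * 1) \<gamma> = coeff a \<gamma>" by simp
  qed
  show "(a + b) * c = a * c + b * c"
    by (rule grassmann_eqI)
      (simp add: times_grassmann.rep_eq plus_grassmann.rep_eq algebra_simps sum.distrib)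
  show "a * (b + c) = a * b + a * c"
    by (rule grassmann_eqI)
      (simp add: times_grassmann.rep_eq plus_grassmann.rep_eq algebra_simps sum.distrib)
  show "(0 :: ('a, 'b) grassmann) \<noteq> 1"
    by transfer (metis zero_neq_one)
qed (transfer; simp add: algebra_simps fun_eq_iff)+

end

lift_definition gscale :: "'a::comm_ring_1 \<Rightarrow> ('a, 'n::{finite,linorder}) grassmann \<Rightarrow> ('a, 'n) grassmann"
  is "\<lambda>k a \<alpha>. k * a \<alpha>" .

lift_definition monomial :: "'n::{finite,linorder} set \<Rightarrow> ('a::comm_ring_1, 'n) grassmann"
  is "\<lambda>\<alpha> \<beta>. if \<beta> = \<alpha> then 1 else 0" .

abbreviation gvar :: "'n::{finite,linorder} \<Rightarrow> ('a::comm_ring_1, 'n) grassmann" where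
  "gvar i \<equiv> monomial {i}"

lemmas coeff_simps [simp] = zero_grassmann.rep_eq one_grassmann.rep_eq plus_grassmann.rep_eq
  uminus_grassmann.rep_eq minus_grassmann.rep_eq gscale.rep_eq monomial.rep_eq

global_interpretation grassmann: module gscale
  by unfold_locales (rule grassmann_eqI; simp add: algebra_simps)+

lemma coeff_sum [simp]: "coeff (sum f A) \<alpha> = (\<Sum>i\<in>A. coeff (f i) \<alpha>)"
  by (induction A rule: infinite_finite_induct) auto

lemma gscale_mult_left: "gscale k a * b = gscale k (a * b)"
  by (rule grassmann_eqI) (simp add: times_grassmann.rep_eq sum_distrib_left mult_ac)

lemma gscale_mult_right: "a * gscale k b = gscale k (a * b)"
  by (rule grassmann_eqI) (simp add: times_grassmann.rep_eq sum_distrib_left mult_ac)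

lemma monomial_empty [simp]: "monomial {} = 1"
  by (rule grassmann_eqI) simp

lemma monomial_mult:
  "monomial \<alpha> * monomial \<beta> = (if \<alpha> \<inter> \<beta> = {} then gscale (koszul_sign \<alpha> \<beta>) (monomial (\<alpha> \<union> \<beta>)) else 0)"
proof (rule grassmann_eqI)
  fix \<gamma>
  have "coeff (monomial \<alpha> * monomial \<beta> :: ('a, 'b) grassmann) \<gamma>
      = (\<Sum>\<delta>\<in>Pow \<gamma>. if \<delta> = \<alpha> then (if \<gamma> - \<alpha> = \<beta> then koszul_sign \<alpha> \<beta> else 0) else 0)"
    unfolding times_grassmann.rep_eq monomial.rep_eq by (intro sum.cong) auto
  also have "\<dots> = (if \<alpha> \<subseteq> \<gamma> \<and> \<gamma> - \<alpha> = \<beta> then koszul_sign \<alpha> \<beta> else 0)"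
    by simp
  also have "\<alpha> \<subseteq> \<gamma> \<and> \<gamma> - \<alpha> = \<beta> \<longleftrightarrow> \<alpha> \<inter> \<beta> = {} \<and> \<gamma> = \<alpha> \<union> \<beta>"
    by auto
  finally show "coeff (monomial \<alpha> * monomial \<beta> :: ('a, 'b) grassmann) \<gamma>
    = coeff (if \<alpha> \<inter> \<beta> = {} then gscale (koszul_sign \<alpha> \<beta>) (monomial (\<alpha> \<union> \<beta>)) else 0) \<gamma>"
    by auto
qed

text \<open>
  The defining relations, and the facts that the elements \<open>monomial \<alpha>\<close> are the ordered products
  of the generators and form a basis.
\<close>

lemma X_square: "gvar i * gvar i = 0"
  by (simp add: monomial_mult)

lemma X_anticommute: "i \<noteq> j \<Longrightarrow> gvar i * gvar j = - (gvar j * gvar i)"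
  by (rule grassmann_eqI) (auto simp: monomial_mult koszul_sign_def insert_commute)

lemma monomial_eq_prod_list:
  fixes \<alpha> :: "'n::{finite,linorder} set"
  shows "monomial \<alpha> = (prod_list (map gvar (sorted_list_of_set \<alpha>)) :: ('a::comm_ring_1, 'n) grassmann)"
proof -
  have "monomial (set is) = (prod_list (map gvar is) :: ('a, 'n) grassmann)"
    if "sorted_wrt (<) is" for "is" :: "'n list"
    using that
  proof (induction "is")
    case (Cons i "is")
    then have less: "i < j" if "j \<in> set is" for j
      using that by simp
    then have "koszul_sign {i} (set is) = (1 :: 'a)" "i \<notin> set is"
      by (auto simp: koszul_sign_def intro!: prod.neutral dest!: less)
    with Cons show ?case
      by (simp add: monomial_mult flip: Cons.IH)
  qed simp
  from this [of "sorted_list_of_set \<alpha>"] show ?thesis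
    by simp
qed

lemma grassmann_expansion: "a = (\<Sum>\<alpha>\<in>UNIV. gscale (coeff a \<alpha>) (monomial \<alpha>))"
  by (rule grassmann_eqI) (simp add: if_distrib cong: if_cong)

lemma coeff_linear_combination: "coeff (\<Sum>\<alpha>\<in>UNIV. gscale (k \<alpha>) (monomial \<alpha>)) \<beta> = k \<beta>"
  by (simp add: if_distrib cong: if_cong)

section \<open>Grading\<close>

text \<open>\<open>graded_part D\<close> is the sum of the homogeneous components \<open>\<Lambda>\<^bsub>n,d\<^esub>\<close> with \<open>d \<in> D\<close>.\<close>

definition graded_part :: "nat set \<Rightarrow> ('a::comm_ring_1, 'n::{finite,linorder}) grassmann set" where
  "graded_part D = {a. \<forall>\<alpha>. coeff a \<alpha> \<noteq> 0 \<longrightarrow> card \<alpha> \<in> D}"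

abbreviation odd_part :: "('a::comm_ring_1, 'n::{finite,linorder}) grassmann set" where
  "odd_part \<equiv> graded_part {d. odd d}"

abbreviation pos_even_part :: "('a::comm_ring_1, 'n::{finite,linorder}) grassmann set" where
  "pos_even_part \<equiv> graded_part {d. even d \<and> 2 \<le> d}"

lift_definition hom_component :: "nat \<Rightarrow> ('a::comm_ring_1, 'n::{finite,linorder}) grassmann \<Rightarrow> ('a, 'n) grassmann"
  is "\<lambda>d a \<alpha>. if card \<alpha> = d then a \<alpha> else 0" .

definition ideal_prod :: "'r::ring_1 set \<Rightarrow> 'r set \<Rightarrow> 'r set" where
  "ideal_prod I J = {\<Sum>l<k. a l * b l | k a b. \<forall>l<(k::nat). a l \<in> I \<and> b l \<in> J}"

primrec ideal_power :: "'r::ring_1 set \<Rightarrow> nat \<Rightarrow> 'r set" where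
  "ideal_power I 0 = UNIV"
| "ideal_power I (Suc k) = ideal_prod I (ideal_power I k)"

definition aug_ideal :: "('a::comm_ring_1, 'n::{finite,linorder}) grassmann set" where
  "aug_ideal = graded_part {1..}"

section \<open>Left skew derivations\<close>

definition is_skew_partial :: "'n \<Rightarrow> (('a::comm_ring_1, 'n::{finite,linorder}) grassmann \<Rightarrow> ('a, 'n) grassmann) \<Rightarrow> bool" where
  "is_skew_partial j D \<longleftrightarrow> module_hom gscale gscale D
    \<and> (\<forall>k. D (gvar k) = (if j = k then 1 else 0))
    \<and> (\<forall>d. \<forall>a\<in>graded_part {d}. \<forall>b. D (a * b) = D a * b + (- 1) ^ d * (a * D b))"

definition skew_partial :: "'n \<Rightarrow> ('a::comm_ring_1, 'n::{finite,linorder}) grassmann \<Rightarrow> ('a, 'n) grassmann" where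
  "skew_partial j = (THE D. is_skew_partial j D)"

lift_definition skew_partial_explicit ::
    "'n \<Rightarrow> ('a::comm_ring_1, 'n::{finite,linorder}) grassmann \<Rightarrow> ('a, 'n) grassmann"
  is "\<lambda>j a \<gamma>. if j \<in> \<gamma> then 0 else koszul_sign {j} \<gamma> * a (insert j \<gamma>)" .

lemma is_skew_partial_unique:
  fixes D E :: "('a::comm_ring_1, 'n::{finite,linorder}) grassmann \<Rightarrow> ('a, 'n) grassmann"
  assumes D: "is_skew_partial j D" and E: "is_skew_partial j E"
  shows "D = E"
proof
  fix a
  interpret D: module_hom gscale gscale D using D by (simp add: is_skew_partial_def)
  interpret E: module_hom gscale gscale E using E by (simp add: is_skew_partial_def)
  have hom: "gvar i \<in> graded_part {1}" for i :: 'n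
    by (simp add: graded_part_def)
  have one: "F 1 = 0" if "is_skew_partial j F" for F :: "('a, 'n) grassmann \<Rightarrow> ('a, 'n) grassmann"
  proof -
    have "1 \<in> graded_part {0}" by (simp add: graded_part_def)
    then have "F (1 * 1) = F 1 * 1 + (- 1) ^ 0 * (1 * F 1)"
      using that unfolding is_skew_partial_def by blast
    then show ?thesis by simp
  qed
  have "D (prod_list (map gvar is)) = E (prod_list (map gvar is))" for "is"
  proof (induction "is")
    case Nil
    show ?case using one[OF D] one[OF E] by simp
  next
    case (Cons i "is")
    have leibniz: "F (gvar i * p) = F (gvar i) * p + (- 1) ^ 1 * (gvar i * F p)"
      if "is_skew_partial j F" for F :: "('a, 'n) grassmann \<Rightarrow> ('a, 'n) grassmann" and p
      using that hom unfolding is_skew_partial_def by blast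
    have "D (gvar i) = E (gvar i)"
      using D E by (simp add: is_skew_partial_def)
    then show ?case
      by (simp only: list.map prod_list.Cons leibniz [OF D] leibniz [OF E] Cons)
  qed
  from this [of "sorted_list_of_set _"] have "D (monomial \<alpha>) = E (monomial \<alpha>)" for \<alpha>
    by (simp only: flip: monomial_eq_prod_list)
  then have "D (\<Sum>\<alpha>\<in>UNIV. gscale (coeff a \<alpha>) (monomial \<alpha>)) = E (\<Sum>\<alpha>\<in>UNIV. gscale (coeff a \<alpha>) (monomial \<alpha>))"
    by (simp only: D.sum E.sum D.scale E.scale)
  then show "D a = E a"
    by (simp only: grassmann_expansion [symmetric])
qed

lemma is_skew_partial_explicit:
  fixes j :: "'n::{finite,linorder}"
  shows "is_skew_partial j (skew_partial_explicit j :: ('a::comm_ring_1, 'n) grassmann \<Rightarrow> _)"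
  unfolding is_skew_partial_def
proof (intro conjI allI ballI)
  let ?D = "skew_partial_explicit j :: ('a, 'n) grassmann \<Rightarrow> _"
  show "module_hom gscale gscale ?D"
    by unfold_locales (rule grassmann_eqI; simp add: skew_partial_explicit.rep_eq algebra_simps)+
  show "?D (gvar k) = (if j = k then 1 else 0)" for k
    by (rule grassmann_eqI) (auto simp: skew_partial_explicit.rep_eq)
  fix d and a b :: "('a, 'n) grassmann"
  assume "a \<in> graded_part {d}"
  then have card_a: "card \<alpha> = d" if "coeff a \<alpha> \<noteq> 0" for \<alpha>
    using that by (auto simp: graded_part_def)
  have pow: "coeff ((- 1) ^ d * c) \<gamma> = (- 1) ^ d * coeff c \<gamma>" for c :: "('a, 'n) grassmann" and \<gamma>
    by (induction d) auto
  have split: "sum f (Pow (insert j \<gamma>)) = sum f (Pow \<gamma>) + (\<Sum>\<alpha>\<in>Pow \<gamma>. f (insert j \<alpha>))"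
    if "j \<notin> \<gamma>" for f :: "'n set \<Rightarrow> 'a" and \<gamma>
  proof -
    have "inj_on (insert j) (Pow \<gamma>)"
      using that by (auto simp: inj_on_def)
    moreover have "Pow \<gamma> \<inter> insert j ` Pow \<gamma> = {}"
      using that by auto
    ultimately show ?thesis
      by (simp only: Pow_insert sum.union_disjoint [OF finite finite] sum.reindex comp_def)
  qed
  show "?D (a * b) = ?D a * b + (- 1) ^ d * (a * ?D b)"
  proof (rule grassmann_eqI)
    fix \<gamma>
    show "coeff (?D (a * b)) \<gamma> = coeff (?D a * b + (- 1) ^ d * (a * ?D b)) \<gamma>"
    proof (cases "j \<in> \<gamma>")
      case False
      have A: "koszul_sign {j} \<gamma> * (koszul_sign \<alpha> (insert j \<gamma> - \<alpha>) * coeff a \<alpha> * coeff b (insert j \<gamma> - \<alpha>))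
          = (- 1) ^ d * (koszul_sign \<alpha> (\<gamma> - \<alpha>) * coeff a \<alpha> * coeff (?D b) (\<gamma> - \<alpha>))"
        if "\<alpha> \<subseteq> \<gamma>" for \<alpha>
      proof (cases "coeff a \<alpha> = 0")
        case nz: False
        define \<beta> where "\<beta> = \<gamma> - \<alpha>"
        have \<beta>: "insert j \<gamma> - \<alpha> = \<beta> \<union> {j}" "\<gamma> = \<alpha> \<union> \<beta>" "\<alpha> \<inter> \<beta> = {}" "j \<notin> \<alpha>" "j \<notin> \<beta>"
          using that False by (auto simp: \<beta>_def)
        have "koszul_sign \<alpha> {j} * koszul_sign {j} \<alpha> = (- 1 :: 'a) ^ d"
          using koszul_sign_swap[OF \<beta>(4)] card_a[OF nz] by simp
        then have sgn: "koszul_sign {j} \<gamma> * koszul_sign \<alpha> (\<beta> \<union> {j})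
            = (- 1 :: 'a) ^ d * (koszul_sign \<alpha> \<beta> * koszul_sign {j} \<beta>)"
          by (simp add: \<beta>(2) koszul_sign_Un_right [OF \<beta>(3)] koszul_sign_Un_right [of \<beta> "{j}"] \<beta>(5) mult_ac
              del: Un_insert_right Un_empty_right flip: \<open>_ = (- 1) ^ d\<close>)
        have "koszul_sign {j} \<gamma> * (koszul_sign \<alpha> (\<beta> \<union> {j}) * coeff a \<alpha> * coeff b (\<beta> \<union> {j}))
            = koszul_sign {j} \<gamma> * koszul_sign \<alpha> (\<beta> \<union> {j}) * (coeff a \<alpha> * coeff b (\<beta> \<union> {j}))"
          by (simp only: mult_ac)
        moreover have "coeff (?D b) \<beta> = koszul_sign {j} \<beta> * coeff b (\<beta> \<union> {j})"
          using \<beta>(5) by (simp add: skew_partial_explicit.rep_eq)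
        ultimately show ?thesis
          unfolding \<beta>(1) \<beta>_def[symmetric] by (simp only: sgn mult_ac)
      qed simp
      have B: "koszul_sign {j} \<gamma> * (koszul_sign (insert j \<alpha>) (insert j \<gamma> - insert j \<alpha>)
            * coeff a (insert j \<alpha>) * coeff b (insert j \<gamma> - insert j \<alpha>))
          = koszul_sign \<alpha> (\<gamma> - \<alpha>) * coeff (?D a) \<alpha> * coeff b (\<gamma> - \<alpha>)"
        if "\<alpha> \<subseteq> \<gamma>" for \<alpha>
      proof -
        define \<beta> where "\<beta> = \<gamma> - \<alpha>"
        have \<beta>: "insert j \<gamma> - insert j \<alpha> = \<beta>" "\<gamma> = \<alpha> \<union> \<beta>" "\<alpha> \<inter> \<beta> = {}" "j \<notin> \<alpha>" "j \<notin> \<beta>"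
          using that False by (auto simp: \<beta>_def)
        have "koszul_sign {j} \<gamma> = koszul_sign {j} \<alpha> * (koszul_sign {j} \<beta> :: 'a)"
          unfolding \<beta>(2) by (rule koszul_sign_Un_right [OF \<beta>(3)])
        moreover have "koszul_sign (insert j \<alpha>) \<beta> = koszul_sign {j} \<beta> * (koszul_sign \<alpha> \<beta> :: 'a)"
          using koszul_sign_Un_left [of "{j}" \<alpha> \<beta>] \<beta>(4) by simp
        ultimately have "koszul_sign {j} \<gamma> * koszul_sign (insert j \<alpha>) \<beta>
            = koszul_sign {j} \<alpha> * koszul_sign \<alpha> \<beta> * (koszul_sign {j} \<beta> * koszul_sign {j} \<beta> :: 'a)"
          by (simp only: mult_ac)
        then have sgn: "koszul_sign {j} \<gamma> * koszul_sign (insert j \<alpha>) \<beta>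
            = (koszul_sign {j} \<alpha> * koszul_sign \<alpha> \<beta> :: 'a)"
          by simp
        have "koszul_sign {j} \<gamma> * (koszul_sign (insert j \<alpha>) \<beta> * coeff a (insert j \<alpha>) * coeff b \<beta>)
            = koszul_sign {j} \<gamma> * koszul_sign (insert j \<alpha>) \<beta> * (coeff a (insert j \<alpha>) * coeff b \<beta>)"
          by (simp only: mult_ac)
        moreover have "coeff (?D a) \<alpha> = koszul_sign {j} \<alpha> * coeff a (insert j \<alpha>)"
          using \<beta>(4) by (simp add: skew_partial_explicit.rep_eq)
        ultimately show ?thesis
          unfolding \<beta>(1) \<beta>_def[symmetric] by (simp only: sgn mult_ac)
      qed
      let ?f = "\<lambda>\<alpha>. koszul_sign \<alpha> (insert j \<gamma> - \<alpha>) * coeff a \<alpha> * coeff b (insert j \<gamma> - \<alpha>)"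
      have "coeff (?D (a * b)) \<gamma> = koszul_sign {j} \<gamma> * sum ?f (Pow (insert j \<gamma>))"
        using False by (simp only: skew_partial_explicit.rep_eq times_grassmann.rep_eq if_False)
      also have "\<dots> = (\<Sum>\<alpha>\<in>Pow \<gamma>. koszul_sign {j} \<gamma> * ?f \<alpha>)
          + (\<Sum>\<alpha>\<in>Pow \<gamma>. koszul_sign {j} \<gamma> * ?f (insert j \<alpha>))"
        unfolding split [OF False] distrib_left sum_distrib_left ..
      also have "(\<Sum>\<alpha>\<in>Pow \<gamma>. koszul_sign {j} \<gamma> * ?f \<alpha>) = coeff ((- 1) ^ d * (a * ?D b)) \<gamma>"
        unfolding pow times_grassmann.rep_eq [of a] sum_distrib_left by (rule sum.cong [OF refl], rule A) simp
      also have "(\<Sum>\<alpha>\<in>Pow \<gamma>. koszul_sign {j} \<gamma> * ?f (insert j \<alpha>)) = coeff (?D a * b) \<gamma>"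
        unfolding times_grassmann.rep_eq by (rule sum.cong [OF refl], rule B) simp
      finally show ?thesis by (simp add: add.commute)
    next
      case True
      then obtain \<gamma>' where \<gamma>': "\<gamma> = insert j \<gamma>'" "j \<notin> \<gamma>'"
        by (meson mk_disjoint_insert)
      have cancel: "koszul_sign \<alpha> (insert j \<gamma>' - \<alpha>) * coeff (?D a) \<alpha> * coeff b (insert j \<gamma>' - \<alpha>)
          + (- 1) ^ d * (koszul_sign (insert j \<alpha>) (\<gamma>' - \<alpha>) * coeff a (insert j \<alpha>) * coeff (?D b) (\<gamma>' - \<alpha>)) = 0"
        if "\<alpha> \<subseteq> \<gamma>'" for \<alpha>
      proof (cases "coeff a (insert j \<alpha>) = 0")
        case nz: False
        define \<beta> where "\<beta> = \<gamma>' - \<alpha>"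
        have \<beta>: "insert j \<gamma>' - \<alpha> = \<beta> \<union> {j}" "\<alpha> \<inter> \<beta> = {}" "j \<notin> \<alpha>" "j \<notin> \<beta>"
          using that \<gamma>' by (auto simp: \<beta>_def)
        have d: "d = Suc (card \<alpha>)"
          using card_a[OF nz] \<beta>(3) by simp
        have 1: "koszul_sign \<alpha> (\<beta> \<union> {j}) * koszul_sign {j} \<alpha> = (- 1 :: 'a) ^ card \<alpha> * koszul_sign \<alpha> \<beta>"
        proof -
          have "koszul_sign \<alpha> (\<beta> \<union> {j}) = koszul_sign \<alpha> \<beta> * (koszul_sign \<alpha> {j} :: 'a)"
            using \<beta>(4) by (intro koszul_sign_Un_right) simp
          then show ?thesis
            by (simp only: mult_ac flip: koszul_sign_swap [OF \<beta>(3)])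
        qed
        have "koszul_sign (insert j \<alpha>) \<beta> = koszul_sign {j} \<beta> * (koszul_sign \<alpha> \<beta> :: 'a)"
          using koszul_sign_Un_left [of "{j}" \<alpha> \<beta>] \<beta>(3) by simp
        then have 2: "koszul_sign (insert j \<alpha>) \<beta> * koszul_sign {j} \<beta> = (koszul_sign \<alpha> \<beta> :: 'a)"
          using koszul_sign_square [of "{j}" \<beta>, where 'a = 'a]
          by (metis mult.commute mult.left_commute mult_1_right)
        let ?c = "coeff a (insert j \<alpha>) * coeff b (insert j \<beta>)"
        have "koszul_sign \<alpha> (\<beta> \<union> {j}) * coeff (?D a) \<alpha> * coeff b (\<beta> \<union> {j})
            = (koszul_sign \<alpha> (\<beta> \<union> {j}) * koszul_sign {j} \<alpha>) * ?c"
          using \<beta>(3) by (simp add: skew_partial_explicit.rep_eq mult_ac)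
        moreover have "(- 1) ^ d * (koszul_sign (insert j \<alpha>) \<beta> * coeff a (insert j \<alpha>) * coeff (?D b) \<beta>)
            = (- 1) ^ d * (koszul_sign (insert j \<alpha>) \<beta> * koszul_sign {j} \<beta>) * ?c"
          using \<beta>(4) by (simp add: skew_partial_explicit.rep_eq mult_ac)
        ultimately show ?thesis
          unfolding \<beta>(1) \<beta>_def[symmetric] by (simp only: 1 2) (simp add: d)
      next
        case True
        moreover from this have "coeff (?D a) \<alpha> = 0"
          by (simp add: skew_partial_explicit.rep_eq)
        ultimately show ?thesis by simp
      qed
      have lhs: "coeff (?D (a * b)) \<gamma> = 0"
        by (simp add: skew_partial_explicit.rep_eq [of j "a * b"] \<gamma>'(1))
      let ?s = "\<lambda>\<alpha>. koszul_sign \<alpha> (\<gamma> - \<alpha>) :: 'a"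
      have "(\<Sum>\<alpha>\<in>Pow \<gamma>'. ?s (insert j \<alpha>) * coeff (?D a) (insert j \<alpha>) * coeff b (\<gamma> - insert j \<alpha>)) = 0"
        by (simp add: skew_partial_explicit.rep_eq)
      then have "coeff (?D a * b) \<gamma> = (\<Sum>\<alpha>\<in>Pow \<gamma>'. ?s \<alpha> * coeff (?D a) \<alpha> * coeff b (\<gamma> - \<alpha>))"
        unfolding times_grassmann.rep_eq by (subst (1) \<gamma>'(1)) (simp only: split [OF \<gamma>'(2)] add_0_right)
      moreover have "(\<Sum>\<alpha>\<in>Pow \<gamma>'. ?s \<alpha> * coeff a \<alpha> * coeff (?D b) (\<gamma> - \<alpha>)) = 0"
        using \<gamma>' by (intro sum.neutral) (auto simp: skew_partial_explicit.rep_eq)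
      then have "coeff (a * ?D b) \<gamma>
          = (\<Sum>\<alpha>\<in>Pow \<gamma>'. ?s (insert j \<alpha>) * coeff a (insert j \<alpha>) * coeff (?D b) (\<gamma> - insert j \<alpha>))"
        unfolding times_grassmann.rep_eq [of a] by (subst (1) \<gamma>'(1)) (simp only: split [OF \<gamma>'(2)] add_0_left)
      moreover have "\<gamma> - insert j \<alpha> = \<gamma>' - \<alpha>" for \<alpha>
        using \<gamma>' by auto
      ultimately have "coeff (?D a * b + (- 1) ^ d * (a * ?D b)) \<gamma> = 0"
        unfolding plus_grassmann.rep_eq pow
        by (simp only: sum_distrib_left flip: sum.distrib)
          (rule sum.neutral, use cancel in \<open>simp add: \<gamma>'(1)\<close>)
      with lhs show ?thesis by simp
    qed
  qed
qed

lemma skew_partial_eq_explicit: "skew_partial j = skew_partial_explicit j"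
  unfolding skew_partial_def
proof (rule the_equality)
  show "is_skew_partial j (skew_partial_explicit j)"
    by (rule is_skew_partial_explicit)
  show "D = skew_partial_explicit j" if "is_skew_partial j D" for D
    using that is_skew_partial_explicit by (rule is_skew_partial_unique)
qed

lemma is_skew_partial: "is_skew_partial j (skew_partial j)"
  by (simp add: skew_partial_eq_explicit is_skew_partial_explicit)

section \<open>Automorphism groups\<close>

definition algebra_aut ::
    "(('a::comm_ring_1, 'n::{finite,linorder}) grassmann \<Rightarrow> ('a, 'n) grassmann) set" where
  "algebra_aut = {\<sigma>. bij \<sigma> \<and> module_hom gscale gscale \<sigma> \<and> \<sigma> 1 = 1 \<and> (\<forall>a b. \<sigma> (a * b) = \<sigma> a * \<sigma> b)}"

definition Gamma ::
    "(('a::comm_ring_1, 'n::{finite,linorder}) grassmann \<Rightarrow> ('a, 'n) grassmann) set" where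
  "Gamma = {\<sigma> \<in> algebra_aut. \<forall>i. \<sigma> (gvar i) - gvar i \<in> odd_part \<inter> ideal_power aug_ideal 3}"

text \<open>\<open>Gamma_upper k\<close> is \<open>\<Gamma>\<^sup>k\<close>, where \<open>k = 2s + 1\<close>.\<close>

definition Gamma_upper ::
    "nat \<Rightarrow> (('a::comm_ring_1, 'n::{finite,linorder}) grassmann \<Rightarrow> ('a, 'n) grassmann) set" where
  "Gamma_upper k = {\<sigma> \<in> Gamma. \<forall>i. \<sigma> (gvar i) - gvar i \<in> odd_part \<inter> ideal_power aug_ideal k}"

text \<open>
  Leibniz determinant of a square matrix, each product being taken in the order of the rows. It is
  only used for matrices with commuting entries, where this order is irrelevant.
\<close>

definition leibniz_det :: "('n::{finite,linorder} \<Rightarrow> 'n \<Rightarrow> 'r::ring_1) \<Rightarrow> 'r" where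
  "leibniz_det M = (\<Sum>p | p permutes UNIV.
     of_int (sign p) * prod_list (map (\<lambda>i. M i (p i)) (sorted_list_of_set UNIV)))"

definition jacobian ::
    "(('a::comm_ring_1, 'n::{finite,linorder}) grassmann \<Rightarrow> ('a, 'n) grassmann) \<Rightarrow> ('a, 'n) grassmann" where
  "jacobian \<sigma> = leibniz_det (\<lambda>i j. skew_partial j (\<sigma> (gvar i)))"

definition even_units :: "('a::comm_ring_1, 'n::{finite,linorder}) grassmann set" where
  "even_units = {1 + a | a. a \<in> pos_even_part}"

definition even_units_level :: "nat \<Rightarrow> ('a::comm_ring_1, 'n::{finite,linorder}) grassmann set" where
  "even_units_level k = even_units \<inter> {1 + a | a. a \<in> ideal_power aug_ideal k}"

definition Sigma_jac ::
    "(('a::comm_ring_1, 'n::{finite,linorder}) grassmann \<Rightarrow> ('a, 'n) grassmann) set" where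
  "Sigma_jac = {\<sigma> \<in> Gamma. jacobian \<sigma> = 1}"

text \<open>\<open>Gamma_lower k\<close> is the Jacobian ascent \<open>\<Gamma>\<^sub>k\<close>, where \<open>k = 2m\<close>.\<close>

definition Gamma_lower ::
    "nat \<Rightarrow> (('a::comm_ring_1, 'n::{finite,linorder}) grassmann \<Rightarrow> ('a, 'n) grassmann) set" where
  "Gamma_lower k = {\<sigma> \<in> Gamma. jacobian \<sigma> \<in> even_units_level k}"

definition subalgebra_gen ::
    "('a::comm_ring_1, 'n::{finite,linorder}) grassmann set \<Rightarrow> ('a, 'n) grassmann set" where
  "subalgebra_gen S = \<Inter>{B. S \<subseteq> B \<and> grassmann.subspace B \<and> 1 \<in> B \<and> (\<forall>a\<in>B. \<forall>b\<in>B. a * b \<in> B)}"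

text \<open>\<open>Phi_coeffs \<sigma> c\<close> says that \<open>\<sigma>(x\<^sub>i) = x\<^sub>i(1 + c\<^sub>i)\<close> for all \<open>i\<close>, with \<open>c\<^sub>i\<close> free of \<open>x\<^sub>i\<close>.\<close>

definition Phi_coeffs ::
    "(('a::comm_ring_1, 'n::{finite,linorder}) grassmann \<Rightarrow> ('a, 'n) grassmann) \<Rightarrow> ('n \<Rightarrow> ('a, 'n) grassmann) \<Rightarrow> bool" where
  "Phi_coeffs \<sigma> c \<longleftrightarrow> (\<forall>i. c i \<in> subalgebra_gen {gvar j | j. j \<noteq> i} \<inter> pos_even_part
     \<and> \<sigma> (gvar i) = gvar i * (1 + c i))"

definition Phi ::
    "(('a::comm_ring_1, 'n::{finite,linorder}) grassmann \<Rightarrow> ('a, 'n) grassmann) set" where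
  "Phi = {\<sigma> \<in> Gamma. \<exists>c. Phi_coeffs \<sigma> c}"

definition Phi_upper ::
    "nat \<Rightarrow> (('a::comm_ring_1, 'n::{finite,linorder}) grassmann \<Rightarrow> ('a, 'n) grassmann) set" where
  "Phi_upper k = Phi \<inter> Gamma_upper k"

definition tail_span :: "nat \<Rightarrow> 'n \<Rightarrow> ('a::comm_ring_1, 'n::{finite,linorder}) grassmann set" where
  "tail_span d i = grassmann.span {monomial \<alpha> | \<alpha>. card \<alpha> = d \<and> i \<notin> \<alpha> \<and> {i<..} \<subseteq> \<alpha>}"

text \<open>\<open>Phi'_upper k\<close> is \<open>\<Phi>'\<^sup>k\<close>, where \<open>k = 2s + 1\<close>; hence \<open>k - 1 = 2s\<close>.\<close>

definition Phi'_upper ::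
    "nat \<Rightarrow> (('a::comm_ring_1, 'n::{finite,linorder}) grassmann \<Rightarrow> ('a, 'n) grassmann) set" where
  "Phi'_upper k = {\<sigma> \<in> Phi_upper k. \<exists>c. Phi_coeffs \<sigma> c
     \<and> (\<forall>i. hom_component (k - 1) (c i) \<in> tail_span (k - 1) i)}"

definition set_comp :: "('b \<Rightarrow> 'b) set \<Rightarrow> ('b \<Rightarrow> 'b) set \<Rightarrow> ('b \<Rightarrow> 'b) set"  (infixl \<open>\<circ>\<^sub>S\<close> 70) where
  "A \<circ>\<^sub>S B = {a \<circ> b | a b. a \<in> A \<and> b \<in> B}"

end

(*
  The Jacobian obeys the chain rule J(sigma tau) = sigma(J(tau)) J(sigma), so for sigma, phi with the
  same Jacobian one has sigma in phi Sigma, and everything reduces to realising values of J.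

  Gamma^(2s+1) is generated by the elementary automorphisms x_i |-> x_i + u, u = c x^alpha with |alpha|
  odd and at least 2s+1: multiplying on the right by one of them changes, among the coefficients of
  sigma(x_j) of degree at most |alpha|, only that of x^alpha in sigma(x_i).  The Jacobian of an
  elementary automorphism is 1 + du/dx_i, and multiplying on the left by a suitable one removes a
  coefficient of x^beta in J(sigma), beta = alpha - {i}, without changing other coefficients of degree at
  most |beta|.  Taking i to be the largest index outside beta, the automorphisms used lie in
  Phi'^(2s+1), and only the coefficient of J(sigma) in the top degree n is left.

  That coefficient then vanishes automatically.  If "top" denotes the coefficient of x_1...x_n, the
  Berezin change of variables formula top(sigma(f) J(sigma)^(-1)) = top(f) holds for elementary
  automorphisms, hence on all of Gamma, and f = 1 shows that J(sigma)^(-1) has no top coefficient.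
*)

theory Submission
  imports Defs "HOL-Analysis.Determinants"
begin

section \<open>Parity and degree filtration; supercommutativity\<close>

section \<open>Parity and filtration\<close>

text \<open>For odd \<open>d\<close> this is the odd part intersected with the \<open>d\<close>-th
  power of the augmentation ideal, for even \<open>d\<close> the even part intersected with it. One
  index thus carries both the sign rule and the order of vanishing; \<open>filt 0\<close> is the
  even subalgebra and \<open>filt 1\<close> the odd part.\<close>

definition filt :: "nat \<Rightarrow> ('a::comm_ring_1, 'n::{finite,linorder}) grassmann set" where
  "filt d = graded_part {e. d \<le> e \<and> even (e + d)}"

lemma mem_filt: "a \<in> filt d \<longleftrightarrow> (\<forall>\<alpha>. coeff a \<alpha> \<noteq> 0 \<longrightarrow> d \<le> card \<alpha> \<and> even (card \<alpha> + d))"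
  by (simp add: filt_def graded_part_def)

lemma filt_0 [simp]: "0 \<in> filt d"
  by (simp add: mem_filt)

lemma filt_1 [simp]: "1 \<in> filt 0"
  by (simp add: mem_filt)

lemma filt_add: "a \<in> filt d \<Longrightarrow> b \<in> filt d \<Longrightarrow> a + b \<in> filt d"
  unfolding mem_filt plus_grassmann.rep_eq by (metis add_0)

lemma filt_uminus: "a \<in> filt d \<Longrightarrow> - a \<in> filt d"
  by (simp add: mem_filt)

lemma filt_diff: "a \<in> filt d \<Longrightarrow> b \<in> filt d \<Longrightarrow> a - b \<in> filt d"
  using filt_add filt_uminus by (metis uminus_add_conv_diff add.commute)

lemma filt_gscale: "a \<in> filt d \<Longrightarrow> gscale k a \<in> filt d"
  unfolding mem_filt gscale.rep_eq by (metis mult_zero_right)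

lemma filt_sum: "(\<And>i. i \<in> A \<Longrightarrow> f i \<in> filt d) \<Longrightarrow> sum f A \<in> filt d"
  by (induction A rule: infinite_finite_induct) (auto intro: filt_add)

lemma filt_monomial: "d = card \<alpha> \<Longrightarrow> monomial \<alpha> \<in> filt d"
  by (simp add: mem_filt)

lemma filt_gvar: "gvar i \<in> filt 1"
  by (simp add: filt_monomial)

lemma filt_mono: "a \<in> filt d \<Longrightarrow> e \<le> d \<Longrightarrow> even (d + e) \<Longrightarrow> a \<in> filt e"
  unfolding mem_filt by auto

lemma filt_mult:
  assumes "a \<in> filt d" "b \<in> filt e"
  shows "a * b \<in> filt (d + e)"
  unfolding mem_filt
proof (intro allI impI)
  fix \<gamma> assume "coeff (a * b) \<gamma> \<noteq> 0"
  then obtain \<alpha> where \<alpha>: "\<alpha> \<subseteq> \<gamma>" "koszul_sign \<alpha> (\<gamma> - \<alpha>) * coeff a \<alpha> * coeff b (\<gamma> - \<alpha>) \<noteq> 0"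
    unfolding times_grassmann.rep_eq by (meson PowD sum.not_neutral_contains_not_neutral)
  then have "coeff a \<alpha> \<noteq> 0" "coeff b (\<gamma> - \<alpha>) \<noteq> 0"
    by auto
  moreover have "card \<gamma> = card \<alpha> + card (\<gamma> - \<alpha>)"
    using \<alpha>(1) by (metis card_Diff_subset card_mono finite le_add_diff_inverse)
  ultimately show "d + e \<le> card \<gamma> \<and> even (card \<gamma> + (d + e))"
    using assms unfolding mem_filt by (auto intro: add_mono)
qed

lemma filt_mult_0: "a \<in> filt 0 \<Longrightarrow> b \<in> filt e \<Longrightarrow> a * b \<in> filt e"
  using filt_mult[of a 0 b e] by simp

text \<open>For disjoint sets, each pair of indices is out of order in exactly one of the two
  arrangements, so the product of both signs has one factor -1 per pair.\<close>

lemma koszul_sign_commute: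
  fixes \<alpha> \<beta> :: "'n::{finite,linorder} set"
  assumes "\<alpha> \<inter> \<beta> = {}"
  shows "koszul_sign \<alpha> \<beta> = (- 1) ^ (card \<alpha> * card \<beta>) * (koszul_sign \<beta> \<alpha> :: 'a::comm_ring_1)"
proof -
  have "koszul_sign \<beta> \<alpha> = (\<Prod>i\<in>\<alpha>. \<Prod>j\<in>\<beta>. if i < j then - 1 else 1 :: 'a)"
    unfolding koszul_sign_def by (rule prod.swap)
  then have "koszul_sign \<alpha> \<beta> * (koszul_sign \<beta> \<alpha> :: 'a)
      = (\<Prod>i\<in>\<alpha>. \<Prod>j\<in>\<beta>. (if j < i then - 1 else 1) * (if i < j then - 1 else 1))"
    by (simp add: koszul_sign_def prod.distrib)
  also have "\<dots> = (\<Prod>i\<in>\<alpha>. \<Prod>j\<in>\<beta>. - 1)"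
    using assms by (intro prod.cong) (auto simp: not_less_iff_gr_or_eq)
  also have "\<dots> = (- 1) ^ (card \<alpha> * card \<beta>)"
    by (simp add: power_mult mult.commute[of "card \<alpha>"])
  finally show ?thesis
    by (metis koszul_sign_square mult.assoc mult_1_right)
qed

text \<open>Passing to complements in the sum for a coefficient of the product swaps the two
  factors. By parity every nonzero term then picks up the same sign.\<close>

lemma grassmann_supercommute:
  assumes "a \<in> filt d" "b \<in> filt e"
  shows "a * b = gscale ((- 1) ^ (d * e)) (b * a)"
proof (rule grassmann_eqI)
  fix \<gamma>
  have "coeff (a * b) \<gamma> = (\<Sum>\<alpha>\<in>Pow \<gamma>. koszul_sign \<alpha> (\<gamma> - \<alpha>) * coeff a \<alpha> * coeff b (\<gamma> - \<alpha>))"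
    by (simp add: times_grassmann.rep_eq)
  also have "\<dots> = (\<Sum>\<alpha>\<in>Pow \<gamma>. (- 1) ^ (d * e) * (koszul_sign \<alpha> (\<gamma> - \<alpha>) * coeff b \<alpha> * coeff a (\<gamma> - \<alpha>)))"
  proof (rule sum.reindex_bij_witness[where i = "\<lambda>\<alpha>. \<gamma> - \<alpha>" and j = "\<lambda>\<alpha>. \<gamma> - \<alpha>"], goal_cases)
    case (5 \<alpha>)
    have dd: "\<gamma> - (\<gamma> - \<alpha>) = \<alpha>" using 5 by auto
    show ?case
    proof (cases "coeff a \<alpha> = 0 \<or> coeff b (\<gamma> - \<alpha>) = 0")
      case True
      then show ?thesis unfolding dd by auto
    next
      case False
      then have "even (card \<alpha> + d)" "even (card (\<gamma> - \<alpha>) + e)"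
        using assms unfolding mem_filt by auto
      then have "even (card \<alpha> * card (\<gamma> - \<alpha>)) = even (d * e)"
        by auto
      then have "(- 1) ^ (card \<alpha> * card (\<gamma> - \<alpha>)) = (- 1 :: 'a) ^ (d * e)"
        by (simp add: minus_one_power_iff)
      with koszul_sign_commute[of \<alpha> "\<gamma> - \<alpha>", where 'a = 'a]
      have "koszul_sign \<alpha> (\<gamma> - \<alpha>) = (- 1) ^ (d * e) * (koszul_sign (\<gamma> - \<alpha>) \<alpha> :: 'a)"
        by simp
      then show ?thesis
        unfolding dd by (simp only: mult_ac)
    qed
  qed auto
  also have "\<dots> = coeff (gscale ((- 1) ^ (d * e)) (b * a)) \<gamma>"
    by (simp add: times_grassmann.rep_eq sum_distrib_left)
  finally show "coeff (a * b) \<gamma> = coeff (gscale ((- 1) ^ (d * e)) (b * a)) \<gamma>" .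
qed

lemma filt_parts: "\<exists>b\<in>filt 0. \<exists>c\<in>filt 1. a = b + c"
proof (intro bexI)
  show "a = Grassmann (\<lambda>\<alpha>. if even (card \<alpha>) then coeff a \<alpha> else 0)
      + Grassmann (\<lambda>\<alpha>. if odd (card \<alpha>) then coeff a \<alpha> else 0)"
    by (rule grassmann_eqI) (simp add: Grassmann_inverse)
qed (auto simp: mem_filt Grassmann_inverse odd_pos Suc_leI)

lemma even_central:
  assumes "a \<in> filt 0"
  shows "a * b = b * a"
proof -
  obtain c d where "c \<in> filt 0" "d \<in> filt 1" "b = c + d"
    using filt_parts by blast
  then show ?thesis
    using grassmann_supercommute[OF assms, of c 0] grassmann_supercommute[OF assms, of d 1]
    by (simp add: algebra_simps)
qed

lemma gscale_minus_one: "gscale (- 1) a = - a"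
  by (rule grassmann_eqI) simp

lemma odd_anticommute: "a \<in> filt 1 \<Longrightarrow> b \<in> filt 1 \<Longrightarrow> a * b = - (b * a)"
  using grassmann_supercommute[of a 1 b 1] by (simp add: gscale_minus_one)

lemma monomial_mult_overlap: "\<alpha> \<inter> \<beta> \<noteq> {} \<Longrightarrow> monomial \<alpha> * monomial \<beta> = 0"
  by (simp add: monomial_mult)

section \<open>Product rule and degree drop for the skew partial derivatives\<close>

section \<open>Skew derivations\<close>

lemma coeff_skew_partial:
  "coeff (skew_partial j a) \<gamma> = (if j \<in> \<gamma> then 0 else koszul_sign {j} \<gamma> * coeff a (insert j \<gamma>))"
  by (simp add: skew_partial_eq_explicit skew_partial_explicit.rep_eq)

lemma module_hom_skew_partial: "module_hom gscale gscale (skew_partial j)"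
  using is_skew_partial unfolding is_skew_partial_def by blast

global_interpretation skew_partial: module_hom gscale gscale "skew_partial j"
  by (rule module_hom_skew_partial)

lemma skew_partial_gvar: "skew_partial j (gvar k) = (if j = k then 1 else 0)"
  using is_skew_partial unfolding is_skew_partial_def by blast

lemma skew_partial_1 [simp]: "skew_partial j 1 = 0"
  by (rule grassmann_eqI) (simp add: coeff_skew_partial)

lemma filt_skew_partial: "a \<in> filt (Suc d) \<Longrightarrow> skew_partial j a \<in> filt d"
proof -
  assume a: "a \<in> filt (Suc d)"
  show ?thesis
    unfolding mem_filt coeff_skew_partial
  proof (intro allI impI)
    fix \<gamma> assume "(if j \<in> \<gamma> then 0 else koszul_sign {j} \<gamma> * coeff a (insert j \<gamma>)) \<noteq> 0"
    then have "j \<notin> \<gamma>" "coeff a (insert j \<gamma>) \<noteq> 0"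
      by (auto split: if_splits)
    then show "d \<le> card \<gamma> \<and> even (card \<gamma> + d)"
      using a unfolding mem_filt by (metis Suc_le_mono add_Suc add_Suc_right card_insert_disjoint even_Suc finite)
  qed
qed

text \<open>\<open>filt_skew_partial\<close> would need a level below 0 here. The constant term has
  derivative 0, and after removing it the element lies in \<open>filt 2\<close>.\<close>

lemma filt_skew_partial_0:
  assumes "a \<in> filt 0"
  shows "skew_partial j a \<in> filt 1"
proof -
  have "a - gscale (coeff a {}) 1 \<in> filt 2"
    unfolding mem_filt
  proof (intro allI impI)
    fix \<alpha> assume *: "coeff (a - gscale (coeff a {}) 1) \<alpha> \<noteq> 0"
    then have "\<alpha> \<noteq> {}"
      by auto
    then have "card \<alpha> \<noteq> 0" "even (card \<alpha>)"
      using * assms unfolding mem_filt by auto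
    then show "2 \<le> card \<alpha> \<and> even (card \<alpha> + 2)"
      by presburger
  qed
  then have "skew_partial j (a - gscale (coeff a {}) 1) \<in> filt 1"
    by (intro filt_skew_partial) (simp add: numeral_2_eq_2)
  then show ?thesis
    by (simp add: skew_partial.diff skew_partial.scale)
qed

text \<open>The sign in the homogeneous rule depends only on the parity of the degree, which is
  constant on \<open>filt d\<close>; so the rule extends by linearity from the monomials of
  \<open>a\<close>.\<close>

lemma skew_partial_mult:
  assumes "a \<in> filt d"
  shows "skew_partial j (a * b) = skew_partial j a * b + (- 1) ^ d * (a * skew_partial j b)"
proof -
  have "skew_partial j (gscale (coeff a \<alpha>) (monomial \<alpha>) * b)
      = skew_partial j (gscale (coeff a \<alpha>) (monomial \<alpha>)) * b
        + (- 1) ^ d * (gscale (coeff a \<alpha>) (monomial \<alpha>) * skew_partial j b)" for \<alpha>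
  proof (cases "coeff a \<alpha> = 0")
    case False
    have "gscale (coeff a \<alpha>) (monomial \<alpha>) \<in> graded_part {card \<alpha>}"
      by (simp add: graded_part_def)
    moreover have "(- 1) ^ card \<alpha> = (- 1 :: ('a, 'b) grassmann) ^ d"
      using assms False unfolding mem_filt by (simp add: minus_one_power_iff)
    ultimately show ?thesis
      using is_skew_partial[of j] unfolding is_skew_partial_def by metis
  qed simp
  then have "skew_partial j ((\<Sum>\<alpha>\<in>UNIV. gscale (coeff a \<alpha>) (monomial \<alpha>)) * b)
      = skew_partial j (\<Sum>\<alpha>\<in>UNIV. gscale (coeff a \<alpha>) (monomial \<alpha>)) * b
        + (- 1) ^ d * ((\<Sum>\<alpha>\<in>UNIV. gscale (coeff a \<alpha>) (monomial \<alpha>)) * skew_partial j b)"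
    by (simp only: sum_distrib_right sum_distrib_left skew_partial.sum sum.distrib)
  then show ?thesis
    by (simp only: grassmann_expansion [symmetric])
qed

lemma skew_partial_mult_even:
  "a \<in> filt 0 \<Longrightarrow> skew_partial j (a * b) = skew_partial j a * b + a * skew_partial j b"
  using skew_partial_mult[of a 0] by simp

lemma skew_partial_mult_odd:
  "a \<in> filt 1 \<Longrightarrow> skew_partial j (a * b) = skew_partial j a * b - a * skew_partial j b"
  using skew_partial_mult[of a 1] by simp

lemma skew_partial_skew_partial [simp]: "skew_partial j (skew_partial j a) = 0"
  by (rule grassmann_eqI) (simp add: coeff_skew_partial)

section \<open>Endomorphisms and induction over monomials\<close>

section \<open>Algebra homomorphisms\<close>

locale grassmann_hom = module_hom gscale gscale \<sigma>
  for \<sigma> :: "('a::comm_ring_1, 'n::{finite,linorder}) grassmann \<Rightarrow> ('a, 'n) grassmann" +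
  assumes hom_1 [simp]: "\<sigma> 1 = 1" and hom_mult: "\<sigma> (a * b) = \<sigma> a * \<sigma> b"
begin

lemma hom_prod_list: "\<sigma> (prod_list xs) = prod_list (map \<sigma> xs)"
  by (induction xs) (auto simp: hom_mult)

lemma hom_of_int: "\<sigma> (of_int k) = of_int k"
proof -
  have "\<sigma> (of_nat m) = of_nat m" for m
    by (induction m) (simp_all add: add)
  then show ?thesis
    by (cases k) (simp_all add: neg diff)
qed

end

lemma algebra_aut_iff: "\<sigma> \<in> algebra_aut \<longleftrightarrow> bij \<sigma> \<and> grassmann_hom \<sigma>"
  unfolding algebra_aut_def grassmann_hom_def grassmann_hom_axioms_def by auto

text \<open>A monomial is an ordered product of generators, and \<open>P\<close> is carried along
  the whole list. The degree is an argument of \<open>P\<close> so that the step can use the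
  filtration level of the remaining factor.\<close>

lemma monomial_induct [case_names empty gvar]:
  fixes P :: "nat \<Rightarrow> ('a::comm_ring_1, 'n::{finite,linorder}) grassmann \<Rightarrow> bool"
  assumes "P 0 1" and "\<And>i d m. m \<in> filt d \<Longrightarrow> P d m \<Longrightarrow> P (Suc d) (gvar i * m)"
  shows "P (card \<alpha>) (monomial \<alpha>)"
proof -
  have "(prod_list (map gvar xs) :: ('a, 'n) grassmann) \<in> filt (length xs) \<and> P (length xs) (prod_list (map gvar xs))" for xs :: "'n list"
  proof (induction xs)
    case (Cons x xs)
    then have 1: "(prod_list (map gvar xs) :: ('a, 'n) grassmann) \<in> filt (length xs)" and 2: "P (length xs) (prod_list (map gvar xs))"
      by simp_all
    have "gvar x * (prod_list (map gvar xs) :: ('a, 'n) grassmann) \<in> filt (1 + length xs)"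
      by (rule filt_mult[OF filt_gvar 1])
    then show ?case
      using assms(2)[OF 1 2, of x] by simp
  qed (simp add: assms)
  from this[of "sorted_list_of_set \<alpha>"] show ?thesis
    by (simp flip: monomial_eq_prod_list)
qed

lemma linear_eqI:
  assumes "module_hom gscale gscale f" "module_hom gscale gscale g" "\<And>\<alpha>. f (monomial \<alpha>) = g (monomial \<alpha>)"
  shows "f a = (g a :: ('a::comm_ring_1, 'n::{finite,linorder}) grassmann)"
proof -
  have "f (\<Sum>\<alpha>\<in>UNIV. gscale (coeff a \<alpha>) (monomial \<alpha>)) = g (\<Sum>\<alpha>\<in>UNIV. gscale (coeff a \<alpha>) (monomial \<alpha>))"
    by (simp only: module_hom.sum[OF assms(1)] module_hom.sum[OF assms(2)]
      module_hom.scale[OF assms(1)] module_hom.scale[OF assms(2)] assms(3))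
  then show ?thesis
    by (simp only: grassmann_expansion [symmetric])
qed

lemma grassmann_hom_eqI:
  assumes "grassmann_hom \<sigma>" "grassmann_hom \<tau>" "\<And>i. \<sigma> (gvar i) = \<tau> (gvar i)"
  shows "\<sigma> = \<tau>"
proof
  interpret \<sigma>: grassmann_hom \<sigma> by fact
  interpret \<tau>: grassmann_hom \<tau> by fact
  fix a
  show "\<sigma> a = \<tau> a"
  proof (rule linear_eqI[of \<sigma> \<tau>])
    show "\<sigma> (monomial \<alpha>) = \<tau> (monomial \<alpha>)" for \<alpha>
      by (rule monomial_induct[of "\<lambda>_ m. \<sigma> m = \<tau> m"]) (auto simp: \<sigma>.hom_mult \<tau>.hom_mult assms(3))
  qed (unfold_locales)
qed

section \<open>Powers of the augmentation ideal and the filtration on the group\<close>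

section \<open>The group of unipotent automorphisms\<close>

lemma ideal_prod_add:
  assumes "x \<in> ideal_prod I J" "y \<in> ideal_prod I J"
  shows "x + y \<in> ideal_prod I J"
proof -
  obtain k a b where x: "x = (\<Sum>l<k. a l * b l)" "\<forall>l<(k::nat). a l \<in> I \<and> b l \<in> J"
    using assms(1) unfolding ideal_prod_def by blast
  obtain k' a' b' where y: "y = (\<Sum>l<k'. a' l * b' l)" "\<forall>l<(k'::nat). a' l \<in> I \<and> b' l \<in> J"
    using assms(2) unfolding ideal_prod_def by blast
  let ?c = "\<lambda>l. if l < k then a l else a' (l - k)" and ?d = "\<lambda>l. if l < k then b l else b' (l - k)"
  have "(\<Sum>l<k + k'. ?c l * ?d l) = (\<Sum>l<k. ?c l * ?d l) + (\<Sum>l<k'. ?c (k + l) * ?d (k + l))"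
    by (induction k') (auto simp: algebra_simps)
  then have "x + y = (\<Sum>l<k + k'. ?c l * ?d l)"
    unfolding x y by simp
  moreover have "\<forall>l<k + k'. ?c l \<in> I \<and> ?d l \<in> J"
    using x y by auto
  ultimately show ?thesis
    unfolding ideal_prod_def mem_Collect_eq
    by (intro exI[of _ "k + k'"] exI[of _ ?c] exI[of _ ?d] conjI)
qed

lemma ideal_prod_sum:
  "(\<And>i. i \<in> A \<Longrightarrow> f i \<in> ideal_prod I J) \<Longrightarrow> sum f A \<in> ideal_prod I J"
proof (induction A rule: infinite_finite_induct)
  case (insert x F)
  then show ?case by (simp add: ideal_prod_add)
qed (auto simp: ideal_prod_def intro!: exI[of _ "0::nat"])

lemma ideal_prod_mult: "a \<in> I \<Longrightarrow> b \<in> J \<Longrightarrow> a * b \<in> ideal_prod I J"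
  unfolding ideal_prod_def mem_Collect_eq
  by (intro exI[of _ "Suc 0"] exI[of _ "\<lambda>_. a"] exI[of _ "\<lambda>_. b"]) simp

text \<open>Degrees add under multiplication, which gives one inclusion. Conversely a monomial of
  degree at least k + 1 splits, up to sign, as a generator times a monomial of degree at least
  k.\<close>

lemma ideal_power_aug_ideal:
  "ideal_power aug_ideal k = (graded_part {k..} :: ('a::comm_ring_1, 'n::{finite,linorder}) grassmann set)"
proof (induction k)
  case 0
  show ?case by (simp add: graded_part_def)
next
  case (Suc k)
  show ?case
    unfolding ideal_power.simps Suc
  proof (intro equalityI subsetI)
    fix x :: "('a, 'n) grassmann"
    assume "x \<in> ideal_prod aug_ideal (graded_part {k..})"
    then obtain N a b where x: "x = (\<Sum>l<N. a l * b l)"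
      "\<forall>l<(N::nat). a l \<in> aug_ideal \<and> b l \<in> graded_part {k..}"
      unfolding ideal_prod_def by blast
    show "x \<in> graded_part {Suc k..}"
      unfolding graded_part_def mem_Collect_eq
    proof (intro allI impI)
      fix \<gamma> assume "coeff x \<gamma> \<noteq> 0"
      then obtain l where l: "l < N" "coeff (a l * b l) \<gamma> \<noteq> 0"
        unfolding x(1) coeff_sum by (meson lessThan_iff sum.not_neutral_contains_not_neutral)
      then obtain \<alpha> where \<alpha>: "\<alpha> \<subseteq> \<gamma>" "koszul_sign \<alpha> (\<gamma> - \<alpha>) * coeff (a l) \<alpha> * coeff (b l) (\<gamma> - \<alpha>) \<noteq> 0"
        unfolding times_grassmann.rep_eq by (meson PowD sum.not_neutral_contains_not_neutral)
      then have "coeff (a l) \<alpha> \<noteq> 0" "coeff (b l) (\<gamma> - \<alpha>) \<noteq> 0"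
        by auto
      then have "1 \<le> card \<alpha>" "k \<le> card (\<gamma> - \<alpha>)"
        using x(2) l(1) unfolding aug_ideal_def graded_part_def by auto
      moreover have "card \<gamma> = card \<alpha> + card (\<gamma> - \<alpha>)"
        using \<alpha>(1) by (metis card_Diff_subset card_mono finite le_add_diff_inverse)
      ultimately show "card \<gamma> \<in> {Suc k..}"
        by simp
    qed
  next
    fix x :: "('a, 'n) grassmann"
    assume x: "x \<in> graded_part {Suc k..}"
    have "gscale (coeff x \<alpha>) (monomial \<alpha>) \<in> ideal_prod aug_ideal (graded_part {k..})" for \<alpha>
    proof (cases "coeff x \<alpha> = 0")
      case True
      then show ?thesis
        using ideal_prod_sum[of "{}"] by simp
    next
      case False
      then have c: "Suc k \<le> card \<alpha>"
        using x by (auto simp: graded_part_def)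
      then obtain i where i: "i \<in> \<alpha>"
        by fastforce
      define s :: 'a where "s = koszul_sign {i} (\<alpha> - {i})"
      have "gvar i * monomial (\<alpha> - {i}) = gscale s (monomial \<alpha> :: ('a, 'n) grassmann)"
        using i by (simp add: monomial_mult s_def insert_absorb)
      then have "gscale (coeff x \<alpha>) (monomial \<alpha>) = gvar i * gscale (coeff x \<alpha> * s) (monomial (\<alpha> - {i}))"
        by (simp add: gscale_mult_right mult.assoc) (simp add: s_def)
      moreover have "gvar i \<in> (aug_ideal :: ('a, 'n) grassmann set)"
        by (simp add: aug_ideal_def graded_part_def)
      moreover have "gscale (coeff x \<alpha> * s) (monomial (\<alpha> - {i})) \<in> graded_part {k..}"
        using c i by (auto simp: graded_part_def)
      ultimately show ?thesis
        by (simp add: ideal_prod_mult)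
    qed
    then have "(\<Sum>\<alpha>\<in>UNIV. gscale (coeff x \<alpha>) (monomial \<alpha>)) \<in> ideal_prod aug_ideal (graded_part {k..})"
      by (intro ideal_prod_sum)
    then show "x \<in> ideal_prod aug_ideal (graded_part {k..})"
      by (simp only: grassmann_expansion [symmetric])
  qed
qed

lemma odd_part_power: "odd k \<Longrightarrow> odd_part \<inter> ideal_power aug_ideal k = filt k"
  unfolding ideal_power_aug_ideal graded_part_def filt_def by auto

lemma Gamma_iff:
  "\<sigma> \<in> Gamma \<longleftrightarrow> bij \<sigma> \<and> grassmann_hom \<sigma> \<and> (\<forall>i. \<sigma> (gvar i) - gvar i \<in> filt 3)"
  unfolding Gamma_def by (simp add: algebra_aut_iff odd_part_power)

lemma Gamma_upper_iff:
  "odd k \<Longrightarrow> \<sigma> \<in> Gamma_upper k \<longleftrightarrow> \<sigma> \<in> Gamma \<and> (\<forall>i. \<sigma> (gvar i) - gvar i \<in> filt k)"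
  unfolding Gamma_upper_def by (simp add: odd_part_power)

text \<open>From level 2 on, \<open>filt k\<close> contains no constants, so the two conditions on a
  - 1, being even of positive degree and lying in the ideal power, merge into one.\<close>

lemma even_units_level_iff:
  assumes "even k" "2 \<le> k"
  shows "a \<in> even_units_level k \<longleftrightarrow> a - 1 \<in> (filt k :: ('a::comm_ring_1, 'b::{finite,linorder}) grassmann set)"
proof -
  have "pos_even_part \<inter> ideal_power aug_ideal k = (filt k :: ('a, 'b) grassmann set)"
    using assms unfolding ideal_power_aug_ideal graded_part_def filt_def by auto
  moreover have "even_units_level k = {1 + a | a :: ('a, 'b) grassmann. a \<in> pos_even_part \<inter> ideal_power aug_ideal k}"
    unfolding even_units_level_def even_units_def by auto
  ultimately have "even_units_level k = {1 + a | a :: ('a, 'b) grassmann. a \<in> filt k}"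
    by (simp only:)
  moreover have "a = 1 + (a - 1)"
    by simp
  ultimately show ?thesis
    by force
qed

text \<open>Replacing a factor x_i of a monomial by a term of \<sigma>(x_i) - x_i raises the degree
  by at least 2 and keeps the parity. This is why the lowest coefficients can be controlled one at a
  time later on.\<close>

lemma Gamma_filt_diff:
  assumes \<sigma>: "\<sigma> \<in> Gamma" and a: "a \<in> filt d"
  shows "\<sigma> a - a \<in> filt (d + 2)"
proof -
  interpret grassmann_hom \<sigma> using \<sigma> by (simp add: Gamma_iff)
  have 3: "\<sigma> (gvar i) - gvar i \<in> filt 3" for i
    using \<sigma> by (simp add: Gamma_iff)
  have *: "\<sigma> (monomial \<alpha>) - monomial \<alpha> \<in> filt (card \<alpha> + 2)" for \<alpha>
  proof (rule monomial_induct)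
    fix i d m
    assume m: "m \<in> filt d" and IH: "\<sigma> m - m \<in> filt (d + 2)"
    have "\<sigma> (gvar i * m) - gvar i * m = (\<sigma> (gvar i) - gvar i) * (\<sigma> m - m)
      + (\<sigma> (gvar i) - gvar i) * m + gvar i * (\<sigma> m - m)"
      by (simp add: hom_mult algebra_simps)
    moreover have "(\<sigma> (gvar i) - gvar i) * (\<sigma> m - m) \<in> filt (3 + (d + 2))"
      by (intro filt_mult 3 IH)
    moreover have "(\<sigma> (gvar i) - gvar i) * m \<in> filt (3 + d)"
      by (intro filt_mult 3 m)
    moreover have "gvar i * (\<sigma> m - m) \<in> filt (1 + (d + 2))"
      by (intro filt_mult filt_gvar IH)
    ultimately show "\<sigma> (gvar i * m) - gvar i * m \<in> filt (Suc d + 2)"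
      by (auto intro!: filt_add elim: filt_mono)
  qed simp
  have "gscale (coeff a \<alpha>) (\<sigma> (monomial \<alpha>) - monomial \<alpha>) \<in> filt (d + 2)" for \<alpha>
  proof (cases "coeff a \<alpha> = 0")
    case False
    then have "d \<le> card \<alpha>" "even (card \<alpha> + d)"
      using a by (auto simp: mem_filt)
    then show ?thesis
      by (intro filt_gscale filt_mono[OF *]) auto
  qed simp
  then have "(\<Sum>\<alpha>\<in>UNIV. gscale (coeff a \<alpha>) (\<sigma> (monomial \<alpha>) - monomial \<alpha>)) \<in> filt (d + 2)"
    by (intro filt_sum)
  also have "(\<Sum>\<alpha>\<in>UNIV. gscale (coeff a \<alpha>) (\<sigma> (monomial \<alpha>) - monomial \<alpha>))
      = \<sigma> (\<Sum>\<alpha>\<in>UNIV. gscale (coeff a \<alpha>) (monomial \<alpha>)) - (\<Sum>\<alpha>\<in>UNIV. gscale (coeff a \<alpha>) (monomial \<alpha>))"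
    by (simp only: sum scale grassmann.scale_right_diff_distrib sum_subtractf)
  finally show ?thesis
    by (simp only: grassmann_expansion [symmetric])
qed

lemma Gamma_filt:
  assumes "\<sigma> \<in> Gamma" "a \<in> filt d"
  shows "\<sigma> a \<in> filt d"
proof -
  have "\<sigma> a - a \<in> filt d"
    using Gamma_filt_diff[OF assms] by (rule filt_mono) auto
  then show ?thesis
    using filt_add[OF _ assms(2)] by fastforce
qed

lemma grassmann_hom_comp: "grassmann_hom \<sigma> \<Longrightarrow> grassmann_hom \<tau> \<Longrightarrow> grassmann_hom (\<sigma> \<circ> \<tau>)"
  unfolding grassmann_hom_def grassmann_hom_axioms_def
  by (auto intro: module_hom_compose)

lemma Gamma_hom: "\<sigma> \<in> Gamma \<Longrightarrow> grassmann_hom \<sigma>"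
  by (simp add: Gamma_iff)

lemma Gamma_comp:
  assumes "\<sigma> \<in> Gamma" "\<tau> \<in> Gamma"
  shows "\<sigma> \<circ> \<tau> \<in> Gamma"
proof -
  interpret \<sigma>: grassmann_hom \<sigma> using assms by (simp add: Gamma_iff)
  have "(\<sigma> \<circ> \<tau>) (gvar i) - gvar i = \<sigma> (\<tau> (gvar i) - gvar i) + (\<sigma> (gvar i) - gvar i)" for i
    by (simp add: \<sigma>.diff)
  moreover have "\<sigma> (\<tau> (gvar i) - gvar i) + (\<sigma> (gvar i) - gvar i) \<in> filt 3" for i
    using assms by (intro filt_add Gamma_filt[OF assms(1)]) (simp_all add: Gamma_iff)
  ultimately show ?thesis
    using assms by (simp only: Gamma_iff) (blast intro: bij_comp grassmann_hom_comp)
qed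

section \<open>Determinants over the even subalgebra and the chain rule\<close>

section \<open>The Jacobian and the chain rule\<close>

text \<open>The even subalgebra is a commutative ring; as a type of its own it gives access to the
  theory of \<open>det\<close>, in particular to multiplicativity.\<close>

typedef (overloaded) ('a::comm_ring_1, 'n::"{finite,linorder}") even_grassmann = "filt 0 :: ('a, 'n) grassmann set"
  by (rule exI[of _ 0]) simp

setup_lifting type_definition_even_grassmann

instantiation even_grassmann :: (comm_ring_1, "{finite,linorder}") comm_ring_1
begin

lift_definition zero_even_grassmann :: "('a, 'b) even_grassmann" is 0 by simp
lift_definition one_even_grassmann :: "('a, 'b) even_grassmann" is 1 by simp
lift_definition plus_even_grassmann ::
  "('a, 'b) even_grassmann \<Rightarrow> ('a, 'b) even_grassmann \<Rightarrow> ('a, 'b) even_grassmann" is "(+)" by (rule filt_add)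
lift_definition uminus_even_grassmann ::
  "('a, 'b) even_grassmann \<Rightarrow> ('a, 'b) even_grassmann" is uminus by (rule filt_uminus)
lift_definition minus_even_grassmann ::
  "('a, 'b) even_grassmann \<Rightarrow> ('a, 'b) even_grassmann \<Rightarrow> ('a, 'b) even_grassmann" is "(-)" by (rule filt_diff)
lift_definition times_even_grassmann ::
  "('a, 'b) even_grassmann \<Rightarrow> ('a, 'b) even_grassmann \<Rightarrow> ('a, 'b) even_grassmann" is "(*)" by (rule filt_mult_0)

instance
  by standard (transfer; simp add: algebra_simps even_central)+

end

abbreviation "rep_even \<equiv> Rep_even_grassmann"
abbreviation "abs_even \<equiv> Abs_even_grassmann"

lemma rep_even_sum: "rep_even (sum f A) = (\<Sum>i\<in>A. rep_even (f i))"
  by (induction A rule: infinite_finite_induct)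
    (auto simp: zero_even_grassmann.rep_eq plus_even_grassmann.rep_eq)

lemma rep_even_prod_list: "rep_even (prod_list xs) = prod_list (map rep_even xs)"
  by (induction xs) (auto simp: one_even_grassmann.rep_eq times_even_grassmann.rep_eq)

lemma rep_even_of_int: "rep_even (of_int k) = of_int k"
proof -
  have "rep_even (of_nat m) = of_nat m" for m
    by (induction m)
      (simp_all add: zero_even_grassmann.rep_eq plus_even_grassmann.rep_eq one_even_grassmann.rep_eq)
  then show ?thesis
    by (cases k) (simp_all add: minus_even_grassmann.rep_eq uminus_even_grassmann.rep_eq one_even_grassmann.rep_eq)
qed

text \<open>Even entries commute, so the product in row order agrees with the unordered product in
  \<open>det\<close>.\<close>

lemma leibniz_det_rep_even:
  fixes M :: "('a::comm_ring_1, 'n::{finite,linorder}) even_grassmann ^ 'm::{finite,linorder} ^ 'm::{finite,linorder}"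
  shows "leibniz_det (\<lambda>i j. rep_even (M $ i $ j)) = rep_even (det M)"
proof -
  have "prod_list (map (\<lambda>i. rep_even (M $ i $ p i)) (sorted_list_of_set UNIV))
      = rep_even (\<Prod>i\<in>UNIV. M $ i $ p i)" for p
    using prod.distinct_set_conv_list[of "sorted_list_of_set UNIV" "\<lambda>i. M $ i $ p i"]
    by (simp add: rep_even_prod_list comp_def)
  then show ?thesis
    unfolding leibniz_det_def det_def
    by (simp add: rep_even_sum rep_even_of_int times_even_grassmann.rep_eq)
qed

lemma leibniz_det_mult:
  fixes A B :: "'m::{finite,linorder} \<Rightarrow> 'm \<Rightarrow> ('a::comm_ring_1, 'n::{finite,linorder}) grassmann"
  assumes "\<And>i j. A i j \<in> filt 0" "\<And>i j. B i j \<in> filt 0"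
  shows "leibniz_det (\<lambda>i j. \<Sum>k\<in>UNIV. A i k * B k j) = leibniz_det A * leibniz_det B"
proof -
  define A' B' where "A' = (\<chi> i j. abs_even (A i j))" and "B' = (\<chi> i j. abs_even (B i j))"
  have A: "A = (\<lambda>i j. rep_even (A' $ i $ j))" and B: "B = (\<lambda>i j. rep_even (B' $ i $ j))"
    by (simp_all add: A'_def B'_def Abs_even_grassmann_inverse assms)
  have "leibniz_det (\<lambda>i j. \<Sum>k\<in>UNIV. A i k * B k j) = leibniz_det (\<lambda>i j. rep_even ((A' ** B') $ i $ j))"
    unfolding A B by (simp add: matrix_matrix_mult_def rep_even_sum times_even_grassmann.rep_eq)
  also have "\<dots> = leibniz_det A * leibniz_det B"
    unfolding A B leibniz_det_rep_even by (simp add: det_mul times_even_grassmann.rep_eq)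
  finally show ?thesis .
qed

text \<open>A permutation other than the identity moves at least two points, hence some row
  different from \<open>i\<close>. There the matrix is that of the identity, and the corresponding
  factor vanishes.\<close>

lemma det_row_perturbation:
  fixes v :: "'m::finite \<Rightarrow> 'r::comm_ring_1"
  shows "det (\<chi> k j. (if k = j then 1 else 0) + (if k = i then v j else 0)) = 1 + v i"
proof -
  let ?M = "\<lambda>k j. (if k = j then 1 else 0) + (if k = i then v j else 0)"
  have zero: "of_int (sign p) * (\<Prod>k\<in>UNIV. ?M k (p k)) = 0" if p: "p permutes UNIV" "p \<noteq> id" for p
  proof -
    obtain k where k: "p k \<noteq> k"
      using p(2) by (auto simp: fun_eq_iff)
    \<comment> \<open>If the moved point \<open>k\<close> happens to be \<open>i\<close>, then
      \<open>p k\<close> is a second moved point that differs from \<open>i\<close>.\<close>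
    then have "p (p k) \<noteq> p k"
      using p(1) by (metis permutes_inv_eq)
    then obtain l where "p l \<noteq> l" "l \<noteq> i"
      using k by metis
    then have "?M l (p l) = 0"
      by auto
    then show ?thesis
      by (simp only: prod_zero[OF finite, of UNIV "\<lambda>k. ?M k (p k)"] bexI[OF _ UNIV_I] mult_zero_right)
  qed
  have "det (\<chi> k j. ?M k j) = (\<Sum>p\<in>{p. p permutes UNIV}. of_int (sign p) * (\<Prod>k\<in>UNIV. ?M k (p k)))"
    by (simp add: det_def)
  also have "\<dots> = (\<Sum>p\<in>{id}. of_int (sign p) * (\<Prod>k\<in>UNIV. ?M k (p k)))"
    by (rule sum.mono_neutral_right) (use zero in \<open>auto simp: permutes_id\<close>)
  also have "\<dots> = (\<Prod>k\<in>UNIV. ?M k (id k))"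
    by (simp add: sign_id)
  also have "\<dots> = (\<Prod>k\<in>UNIV. if k = i then 1 + v i else 1)"
    by (intro prod.cong) auto
  finally show ?thesis
    by simp
qed

lemma leibniz_det_row_perturbation:
  fixes v :: "'m::{finite,linorder} \<Rightarrow> ('a::comm_ring_1, 'n::{finite,linorder}) grassmann"
  assumes "\<And>j. v j \<in> filt 0"
  shows "leibniz_det (\<lambda>k j. (if k = j then 1 else 0) + (if k = i then v j else 0)) = 1 + v i"
proof -
  define w where "w = (\<lambda>j. abs_even (v j))"
  have v: "v = (\<lambda>j. rep_even (w j))"
    by (simp add: w_def Abs_even_grassmann_inverse assms)
  let ?M = "(\<chi> k j. (if k = j then 1 else 0) + (if k = i then w j else 0)) :: ('a, 'n) even_grassmann ^ 'm::{finite,linorder} ^ 'm::{finite,linorder}"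
  have "leibniz_det (\<lambda>k j. rep_even (?M $ k $ j)) = 1 + v i"
    unfolding leibniz_det_rep_even det_row_perturbation v
    by (simp add: plus_even_grassmann.rep_eq one_even_grassmann.rep_eq)
  also have "(\<lambda>k j. rep_even (?M $ k $ j)) = (\<lambda>k j. (if k = j then 1 else 0) + (if k = i then v j else 0))"
    by (simp add: fun_eq_iff v plus_even_grassmann.rep_eq one_even_grassmann.rep_eq zero_even_grassmann.rep_eq)
  finally show ?thesis .
qed

lemma (in grassmann_hom) hom_leibniz_det: "\<sigma> (leibniz_det M) = leibniz_det (\<lambda>i j. \<sigma> (M i j))"
  unfolding leibniz_det_def by (simp only: sum hom_mult hom_of_int hom_prod_list map_map comp_def)

lemma Gamma_gvar_odd: "\<sigma> \<in> Gamma \<Longrightarrow> \<sigma> (gvar i) \<in> filt 1"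
  by (rule Gamma_filt[OF _ filt_gvar])

lemma jacobian_entry_even: "\<sigma> \<in> Gamma \<Longrightarrow> skew_partial j (\<sigma> (gvar i)) \<in> filt 0"
  using Gamma_gvar_odd by (intro filt_skew_partial) simp

text \<open>Both sides are linear in \<open>a\<close>, and both turn left multiplication by a
  generator into the same expression by the skew product rule, so monomial induction
  applies.\<close>

lemma chain_rule:
  assumes \<sigma>: "\<sigma> \<in> Gamma"
  shows "skew_partial j (\<sigma> a) = (\<Sum>k\<in>UNIV. \<sigma> (skew_partial k a) * skew_partial j (\<sigma> (gvar k)))"
proof -
  interpret grassmann_hom \<sigma> using \<sigma> by (simp add: Gamma_iff)
  let ?R = "\<lambda>a. \<Sum>k\<in>UNIV. \<sigma> (skew_partial k a) * skew_partial j (\<sigma> (gvar k))"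
  have hom_L: "module_hom gscale gscale (\<lambda>a. skew_partial j (\<sigma> a))"
    by unfold_locales (simp_all add: add scale skew_partial.add skew_partial.scale)
  have hom_R: "module_hom gscale gscale ?R"
    by unfold_locales (simp_all add: add scale skew_partial.add skew_partial.scale distrib_right
      sum.distrib gscale_mult_left grassmann.scale_sum_right)
  have "skew_partial j (\<sigma> (monomial \<alpha>)) = ?R (monomial \<alpha>)" for \<alpha>
  proof (rule monomial_induct[of "\<lambda>_ m. skew_partial j (\<sigma> m) = ?R m"])
    fix i d m
    assume IH: "skew_partial j (\<sigma> m) = ?R m"
    have "?R (gvar i * m) = (\<Sum>k\<in>UNIV. (if k = i then \<sigma> m * skew_partial j (\<sigma> (gvar k)) else 0)
        - \<sigma> (gvar i) * (\<sigma> (skew_partial k m) * skew_partial j (\<sigma> (gvar k))))"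
      by (intro sum.cong refl)
        (auto simp: skew_partial_mult_odd[OF filt_gvar] skew_partial_gvar hom_mult diff neg algebra_simps)
    also have "\<dots> = \<sigma> m * skew_partial j (\<sigma> (gvar i)) - \<sigma> (gvar i) * ?R m"
      by (simp add: sum_subtractf sum_distrib_left)
    \<comment> \<open>The entries of the Jacobian matrix are even; their centrality restores the
      order of factors in the product rule.\<close>
    also have "\<sigma> m * skew_partial j (\<sigma> (gvar i)) = skew_partial j (\<sigma> (gvar i)) * \<sigma> m"
      by (rule even_central[OF jacobian_entry_even[OF \<sigma>], symmetric])
    finally show "skew_partial j (\<sigma> (gvar i * m)) = ?R (gvar i * m)"
      by (simp add: hom_mult skew_partial_mult_odd[OF Gamma_gvar_odd[OF \<sigma>]] IH)
  qed simp
  with hom_L hom_R show ?thesis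
    by (rule linear_eqI)
qed

text \<open>By the chain rule the Jacobian matrix of the composition is the product of the
  \<sigma>-image of the matrix of \<tau> with the matrix of \<sigma>.\<close>

lemma jacobian_comp:
  assumes "\<sigma> \<in> Gamma" "\<tau> \<in> Gamma"
  shows "jacobian (\<sigma> \<circ> \<tau>) = \<sigma> (jacobian \<tau>) * jacobian \<sigma>"
proof -
  interpret grassmann_hom \<sigma> using assms by (simp add: Gamma_iff)
  have "jacobian (\<sigma> \<circ> \<tau>) = leibniz_det (\<lambda>i j. \<Sum>k\<in>UNIV. \<sigma> (skew_partial k (\<tau> (gvar i))) * skew_partial j (\<sigma> (gvar k)))"
    unfolding jacobian_def by (simp add: chain_rule[OF assms(1), symmetric])
  also have "\<dots> = leibniz_det (\<lambda>i k. \<sigma> (skew_partial k (\<tau> (gvar i)))) * jacobian \<sigma>"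
    unfolding jacobian_def
    by (rule leibniz_det_mult) (intro Gamma_filt[OF assms(1)] jacobian_entry_even[OF assms(2)], rule jacobian_entry_even[OF assms(1)])
  finally show ?thesis
    unfolding jacobian_def hom_leibniz_det .
qed

section \<open>Substitutions in one generator and their Berezin formula\<close>

section \<open>Elementary automorphisms\<close>

text \<open>The exponential of the derivation u d/dx_i, cut off after the linear term; for suitable
  \<open>u\<close> this is the substitution x_i -> x_i + u that fixes the other generators. The
  closed formula is at hand for all \<open>f\<close>, not only on generators.\<close>

definition elem :: "'n \<Rightarrow> ('a::comm_ring_1, 'n::{finite,linorder}) grassmann \<Rightarrow> ('a, 'n) grassmann \<Rightarrow> ('a, 'n) grassmann" where
  "elem i u f = f + u * skew_partial i f"

text \<open>The vanishing of u * du/dx_i makes the derivation u d/dx_i square to zero, and u * u = 0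
  kills the quadratic term when two values of \<open>elem i u\<close> are multiplied.\<close>

definition elementary :: "'n \<Rightarrow> ('a::comm_ring_1, 'n::{finite,linorder}) grassmann \<Rightarrow> bool" where
  "elementary i u \<longleftrightarrow> u \<in> filt 3 \<and> u * u = 0 \<and> u * skew_partial i u = 0"

lemma skew_partial_monomial:
  "skew_partial i (monomial \<alpha>)
    = (if i \<in> \<alpha> then gscale (koszul_sign {i} (\<alpha> - {i})) (monomial (\<alpha> - {i})) else 0)"
  by (rule grassmann_eqI) (auto simp: coeff_skew_partial)

text \<open>Since \<alpha> has at least three elements, it meets \<alpha> - {i}, so the monomial
  annihilates its own derivative.\<close>

lemma elementary_monomial:
  assumes "odd (card \<alpha>)" "3 \<le> card \<alpha>"
  shows "elementary i (gscale c (monomial \<alpha>))"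
proof -
  have "\<alpha> \<inter> (\<alpha> - {i}) \<noteq> {}" if "i \<in> \<alpha>"
  proof
    assume "\<alpha> \<inter> (\<alpha> - {i}) = {}"
    then have "\<alpha> \<subseteq> {i}" by auto
    then have "card \<alpha> \<le> 1" using card_mono[of "{i}" \<alpha>] by simp
    with assms show False by simp
  qed
  moreover have "\<alpha> \<noteq> {}"
    using assms by auto
  moreover have "(monomial \<alpha> :: ('b, 'a) grassmann) \<in> filt 3"
    using assms by (simp add: mem_filt)
  ultimately show ?thesis
    unfolding elementary_def
    by (simp add: filt_gscale gscale_mult_left gscale_mult_right skew_partial.scale skew_partial_monomial monomial_mult_overlap)
qed

lemma elementary_uminus: "elementary i u \<Longrightarrow> elementary i (- u)"
  by (simp add: elementary_def filt_uminus skew_partial.neg)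

lemma elem_gvar: "elem i u (gvar k) = gvar k + (if k = i then u else 0)"
  by (simp add: elem_def skew_partial_gvar)

context
  fixes i :: "'n::{finite,linorder}" and u :: "('a::comm_ring_1, 'n) grassmann"
  assumes u: "elementary i u"
begin

lemma elementary_odd: "u \<in> filt 1"
  by (rule filt_mono[of u 3]) (use u in \<open>simp_all add: elementary_def\<close>)

lemma elementary_partial: "skew_partial i u \<in> filt 2"
  by (rule filt_skew_partial) (use u in \<open>simp add: elementary_def\<close>)

lemma elementary_partial_even: "skew_partial i u \<in> filt 0"
  using elementary_partial by (rule filt_mono) auto

lemma elementary_mult: "u * skew_partial i u = 0" "skew_partial i u * u = 0"
  using u even_central[OF elementary_partial_even, of u] by (auto simp: elementary_def)

text \<open>Differentiate u * du/dx_i = 0 once more; the second derivative drops out.\<close>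

lemma elementary_partial_square: "skew_partial i u * skew_partial i u = 0"
  using skew_partial_mult_odd[OF elementary_odd, of i "skew_partial i u"] by (simp add: elementary_mult)

lemma elementary_square: "u * u = 0"
  using u by (simp add: elementary_def)

text \<open>The odd element \<open>u\<close> can be moved past any element, up to a sign on its odd
  part, until it meets the other copy of itself.\<close>

lemma elementary_absorb: "u * (a * (u * b)) = 0"
proof -
  obtain e o' where e: "e \<in> filt 0" and o': "o' \<in> filt 1" and a: "a = e + o'"
    using filt_parts by blast
  have "u * a = e * u - o' * u"
    using even_central[OF e, of u] odd_anticommute[OF elementary_odd o'] by (simp add: a algebra_simps)
  then have "u * a * (u * b) = (e * u - o' * u) * (u * b)"
    by simp
  also have "\<dots> = e * (u * u) * b - o' * (u * u) * b"
    by (simp add: algebra_simps)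
  finally show ?thesis
    by (simp add: elementary_square mult.assoc)
qed

text \<open>Since u d/dx_i is a derivation, the only obstruction to multiplicativity is the product
  of the two first-order terms, and \<open>elementary_absorb\<close> removes it. The first factor is
  split by parity because the skew product rule depends on it.\<close>

lemma elem_hom: "grassmann_hom (elem i u)"
proof
  fix a b :: "('a, 'n) grassmann"
  obtain e o' where e: "e \<in> filt 0" and o': "o' \<in> filt 1" and a: "a = e + o'"
    using filt_parts by blast
  have 1: "elem i u (c * b) = elem i u c * elem i u b" if "c = e \<or> c = o'" for c
  proof -
    \<comment> \<open>Moving the odd \<open>u\<close> past \<open>c\<close> compensates the sign in
      the skew product rule, so the ordinary Leibniz rule results.\<close>
    have "u * skew_partial i (c * b) = u * skew_partial i c * b + c * (u * skew_partial i b)"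
      using that even_central[OF e, of u] odd_anticommute[OF elementary_odd o']
      by (auto simp: skew_partial_mult_even[OF e] skew_partial_mult_odd[OF o'] distrib_left right_diff_distrib
          simp flip: mult.assoc)
    moreover have "u * skew_partial i c * (u * skew_partial i b) = 0"
      using elementary_absorb by (simp add: mult.assoc)
    ultimately show ?thesis
      by (simp add: elem_def distrib_left distrib_right add_ac)
  qed
  show "elem i u (a * b) = elem i u a * elem i u b"
    using 1[of e] 1[of o']
    by (simp add: a elem_def distrib_left distrib_right skew_partial.add add_ac)
qed (simp_all add: elem_def skew_partial.add skew_partial.scale algebra_simps gscale_mult_right grassmann.scale_right_distrib)

text \<open>The derivation u d/dx_i has square zero, so 1 plus it and 1 minus it are inverse to each
  other.\<close>

lemma elem_inverse: "elem i (- u) (elem i u f) = f"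
proof -
  have "u * skew_partial i (u * skew_partial i f) = u * skew_partial i u * skew_partial i f"
    by (simp add: skew_partial_mult_odd[OF elementary_odd] mult.assoc)
  then show ?thesis
    by (simp add: elem_def skew_partial.add distrib_left elementary_mult)
qed

end

lemma elem_inverse': "elementary i u \<Longrightarrow> elem i u (elem i (- u) f) = f"
  using elem_inverse[OF elementary_uminus] by simp

lemma elem_Gamma: "elementary i u \<Longrightarrow> elem i u \<in> Gamma"
  unfolding Gamma_iff
proof (intro conjI allI)
  assume u: "elementary i u"
  show "bij (elem i u)"
    by (rule bij_betw_byWitness[where f' = "elem i (- u)"]) (auto simp: elem_inverse[OF u] elem_inverse'[OF u])
  show "grassmann_hom (elem i u)"
    by (rule elem_hom[OF u])
  show "elem i u (gvar k) - gvar k \<in> filt 3" for k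
    using u by (auto simp: elem_gvar elementary_def)
qed

text \<open>Only the \<open>i\<close>-th row of the Jacobian matrix differs from that of the
  identity.\<close>

lemma jacobian_elem:
  assumes "elementary i u"
  shows "jacobian (elem i u) = 1 + skew_partial i u"
proof -
  have "skew_partial j u \<in> filt 0" for j
    using filt_skew_partial[of u 0] elementary_odd[OF assms] by simp
  then have "leibniz_det (\<lambda>k j. (if k = j then 1 else 0) + (if k = i then skew_partial j u else 0))
      = 1 + skew_partial i u"
    by (rule leibniz_det_row_perturbation)
  also have "(\<lambda>k j. (if k = j then 1 else 0) + (if k = i then skew_partial j u else 0))
      = (\<lambda>k j. skew_partial j (elem i u (gvar k)))"
    by (auto simp: fun_eq_iff elem_gvar skew_partial.add skew_partial_gvar)
  finally show ?thesis
    unfolding jacobian_def .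
qed

text \<open>The factor is the inverse of the Jacobian 1 + du/dx_i. The difference between the
  product and \<open>f\<close> is the derivative of u * f up to sign, and a derivative by x_i has no
  term containing x_i, hence no top coefficient.\<close>

lemma elem_berezin:
  assumes u: "elementary i u"
  shows "coeff (elem i u f * (1 - skew_partial i u)) UNIV = coeff f UNIV"
proof -
  let ?w = "skew_partial i u"
  have "u * skew_partial i f * ?w = u * ?w * skew_partial i f"
    using even_central[OF elementary_partial_even[OF u], of "skew_partial i f"] by (simp add: mult.assoc)
  then have "elem i u f * (1 - ?w) = f - (?w * f - u * skew_partial i f)"
    using even_central[OF elementary_partial_even[OF u], of f]
    by (simp add: elem_def algebra_simps elementary_mult[OF u])
  also have "?w * f - u * skew_partial i f = skew_partial i (u * f)"
    by (simp add: skew_partial_mult_odd[OF elementary_odd[OF u]])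
  finally show ?thesis
    by (simp add: coeff_skew_partial)
qed

section \<open>Generation of the filtration subgroups by monomial substitutions\<close>

section \<open>Generation by elementary automorphisms\<close>

text \<open>Words growing on the right, to match the induction by right multiplication. They form a
  group once \<open>A\<close> is closed under inverses, see
  \<open>generated_inverse\<close>.\<close>

inductive_set generated :: "('b \<Rightarrow> 'b) set \<Rightarrow> ('b \<Rightarrow> 'b) set" for A where
  generated_id: "id \<in> generated A"
| generated_snoc: "g \<in> generated A \<Longrightarrow> a \<in> A \<Longrightarrow> g \<circ> a \<in> generated A"

lemma generated_base: "a \<in> A \<Longrightarrow> a \<in> generated A"
  using generated_snoc[OF generated_id] by fastforce

lemma generated_comp:
  assumes "g \<in> generated A" "h \<in> generated A"
  shows "g \<circ> h \<in> generated A"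
  using assms(2)
proof induction
  case generated_id
  show ?case using assms(1) by simp
next
  case (generated_snoc h a)
  then show ?case
    using generated.generated_snoc[of "g \<circ> h" A a] by (simp only: comp_assoc)
qed

lemma generated_inverse:
  assumes inv: "\<And>a. a \<in> A \<Longrightarrow> \<exists>b\<in>A. a \<circ> b = id \<and> b \<circ> a = id" and "g \<in> generated A"
  shows "\<exists>h\<in>generated A. g \<circ> h = id \<and> h \<circ> g = id"
  using assms(2)
proof induction
  case generated_id
  show ?case using generated.generated_id[of A] by (intro bexI[of _ id]) auto
next
  case (generated_snoc g a)
  then obtain h b where h: "h \<in> generated A" "g \<circ> h = id" "h \<circ> g = id"
    and b: "b \<in> A" "a \<circ> b = id" "b \<circ> a = id"
    using inv by metis
  have "(g \<circ> a) \<circ> (b \<circ> h) = g \<circ> (a \<circ> b) \<circ> h" "(b \<circ> h) \<circ> (g \<circ> a) = b \<circ> (h \<circ> g) \<circ> a"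
    by (simp_all only: comp_assoc)
  then have "(g \<circ> a) \<circ> (b \<circ> h) = id" "(b \<circ> h) \<circ> (g \<circ> a) = id"
    by (simp_all add: h b)
  then show ?case
    using generated_comp[OF generated_base[OF b(1)] h(1)] by blast
qed

text \<open>The predicate selects pairs of a generator and a monomial, so one family covers both the
  generators of the whole group and the triangular ones.\<close>

definition elems :: "('n \<Rightarrow> 'n set \<Rightarrow> bool) \<Rightarrow>
    (('a::comm_ring_1, 'n::{finite,linorder}) grassmann \<Rightarrow> ('a, 'n) grassmann) set" where
  "elems P = {elem i (gscale c (monomial \<alpha>)) | i c \<alpha>. P i \<alpha> \<and> odd (card \<alpha>) \<and> 3 \<le> card \<alpha>}"

lemma elemsI: "P i \<alpha> \<Longrightarrow> odd (card \<alpha>) \<Longrightarrow> 3 \<le> card \<alpha> \<Longrightarrow> elem i (gscale c (monomial \<alpha>)) \<in> elems P"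
  unfolding elems_def by blast

lemma elemsE:
  assumes "\<tau> \<in> elems P"
  obtains i c \<alpha> where "\<tau> = elem i (gscale c (monomial \<alpha>))" "P i \<alpha>" "odd (card \<alpha>)" "3 \<le> card \<alpha>"
    "elementary i (gscale c (monomial \<alpha>))"
  using assms elementary_monomial unfolding elems_def by blast

lemma elems_Gamma: "\<tau> \<in> elems P \<Longrightarrow> \<tau> \<in> Gamma"
  by (metis elemsE elem_Gamma)

lemma elems_inverse:
  assumes "\<tau> \<in> elems P"
  shows "\<exists>\<tau>'\<in>elems P. \<tau> \<circ> \<tau>' = id \<and> \<tau>' \<circ> \<tau> = id"
proof -
  obtain i c \<alpha> where \<tau>: "\<tau> = elem i (gscale c (monomial \<alpha>))" "P i \<alpha>" "odd (card \<alpha>)" "3 \<le> card \<alpha>"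
    "elementary i (gscale c (monomial \<alpha>))"
    using assms by (rule elemsE)
  have "- gscale c (monomial \<alpha>) = gscale (- c) (monomial \<alpha> :: ('a, 'b) grassmann)"
    by (simp add: grassmann.scale_minus_left)
  moreover have "elem i (gscale (- c) (monomial \<alpha>)) \<in> elems P"
    using \<tau> by (intro elemsI)
  ultimately show ?thesis
    using elem_inverse[OF \<tau>(5)] elem_inverse'[OF \<tau>(5)] unfolding \<tau>(1)
    by (metis (no_types, lifting) comp_apply eq_id_iff ext)
qed

lemma id_Gamma: "id \<in> Gamma"
  unfolding Gamma_iff
proof (intro conjI allI)
  show "grassmann_hom id"
    by unfold_locales auto
qed auto

lemma generated_elems_Gamma: "g \<in> generated (elems P) \<Longrightarrow> g \<in> Gamma"
  by (induction rule: generated.induct) (blast intro: id_Gamma Gamma_comp elems_Gamma)+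

lemma coeff_filt_eq_0: "a \<in> filt d \<Longrightarrow> card \<gamma> < d \<Longrightarrow> coeff a \<gamma> = 0"
  unfolding mem_filt using not_less by blast

lemma comp_elem_gvar:
  assumes "\<sigma> \<in> Gamma"
  shows "(\<sigma> \<circ> elem i u) (gvar j) = \<sigma> (gvar j) + (if j = i then \<sigma> u else 0)"
proof -
  interpret grassmann_hom \<sigma> using assms by (rule Gamma_hom)
  show ?thesis
    by (simp add: elem_gvar add)
qed

text \<open>By \<open>Gamma_filt_diff\<close>, \<sigma> changes the added monomial term only in
  degrees at least two higher, so up to degree |\<alpha>| a single coefficient is affected.\<close>

lemma coeff_comp_elem:
  assumes "\<sigma> \<in> Gamma" "card \<gamma> \<le> card \<alpha>"
  shows "coeff ((\<sigma> \<circ> elem i (gscale c (monomial \<alpha>))) (gvar j)) \<gamma>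
    = coeff (\<sigma> (gvar j)) \<gamma> + (if j = i \<and> \<gamma> = \<alpha> then c else 0)"
proof -
  let ?u = "gscale c (monomial \<alpha>)"
  have "\<sigma> ?u - ?u \<in> filt (card \<alpha> + 2)"
    using assms by (intro Gamma_filt_diff filt_gscale filt_monomial) auto
  then have "coeff (\<sigma> ?u - ?u) \<gamma> = 0"
    by (rule coeff_filt_eq_0) (use assms in simp)
  then have "coeff (\<sigma> ?u) \<gamma> = (if \<gamma> = \<alpha> then c else 0)"
    by auto
  then show ?thesis
    unfolding comp_elem_gvar[OF assms(1)] by auto
qed

lemma Gamma_upper_comp_elem:
  assumes k: "odd k" and \<sigma>: "\<sigma> \<in> Gamma_upper k" and "odd (card \<alpha>)" "3 \<le> card \<alpha>" "k \<le> card \<alpha>"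
  shows "\<sigma> \<circ> elem i (gscale c (monomial \<alpha>)) \<in> Gamma_upper k"
proof -
  have \<sigma>': "\<sigma> \<in> Gamma" "\<sigma> (gvar j) - gvar j \<in> filt k" for j
    using \<sigma> k by (auto simp: Gamma_upper_iff)
  have u: "gscale c (monomial \<alpha>) \<in> filt k"
    using assms by (intro filt_gscale) (auto simp: mem_filt)
  have "(\<sigma> \<circ> elem i (gscale c (monomial \<alpha>))) (gvar j) - gvar j
      = (\<sigma> (gvar j) - gvar j) + (if j = i then \<sigma> (gscale c (monomial \<alpha>)) else 0)" for j
    unfolding comp_elem_gvar[OF \<sigma>'(1)] by simp
  moreover have "(\<sigma> (gvar j) - gvar j) + (if j = i then \<sigma> (gscale c (monomial \<alpha>)) else 0) \<in> filt k" for j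
    using Gamma_filt[OF \<sigma>'(1) u] by (intro filt_add \<sigma>'(2)) auto
  ultimately have "(\<sigma> \<circ> elem i (gscale c (monomial \<alpha>))) (gvar j) - gvar j \<in> filt k" for j
    by (simp only:)
  moreover have "\<sigma> \<circ> elem i (gscale c (monomial \<alpha>)) \<in> Gamma"
    using assms by (intro Gamma_comp \<sigma>' elem_Gamma elementary_monomial)
  ultimately show ?thesis
    using k by (simp add: Gamma_upper_iff del: o_apply)
qed

lemma Gamma_upper_clear:
  assumes k: "odd k" and \<sigma>: "\<sigma> \<in> Gamma_upper k"
    and "finite S" "\<And>i \<alpha>. (i, \<alpha>) \<in> S \<Longrightarrow> odd (card \<alpha>) \<and> 3 \<le> card \<alpha> \<and> k \<le> card \<alpha>"
  shows "\<exists>g\<in>generated (elems (\<lambda>i \<alpha>. k \<le> card \<alpha>)). \<sigma> \<circ> g \<in> Gamma_upper k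
    \<and> (\<forall>(i, \<alpha>)\<in>S. coeff ((\<sigma> \<circ> g) (gvar i)) \<alpha> = 0)"
  using assms(3,4)
\<comment> \<open>Pairs are treated by increasing degree of the monomial: clearing a new one leaves
  the coefficients already cleared at zero.\<close>
proof (induction S rule: finite_ranking_induct[where f = "\<lambda>(i, \<alpha>). card \<alpha>"])
  case empty
  show ?case
    using \<sigma> by (intro bexI[of _ id] generated_id) auto
next
  case (insert x S)
  obtain i \<alpha> where x: "x = (i, \<alpha>)" by (cases x)
  have \<alpha>: "odd (card \<alpha>)" "3 \<le> card \<alpha>" "k \<le> card \<alpha>"
    using insert.prems unfolding x by auto
  have "\<exists>g\<in>generated (elems (\<lambda>i \<alpha>. k \<le> card \<alpha>)). \<sigma> \<circ> g \<in> Gamma_upper k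
    \<and> (\<forall>(i, \<alpha>)\<in>S. coeff ((\<sigma> \<circ> g) (gvar i)) \<alpha> = 0)"
    using insert.prems by (intro insert.IH) auto
  then obtain g where g: "g \<in> generated (elems (\<lambda>i \<alpha>. k \<le> card \<alpha>))" "\<sigma> \<circ> g \<in> Gamma_upper k"
    "\<And>j \<gamma>. (j, \<gamma>) \<in> S \<Longrightarrow> coeff ((\<sigma> \<circ> g) (gvar j)) \<gamma> = 0"
    by fast
  \<comment> \<open>The scalar is the negative of the coefficient to be removed.\<close>
  define \<tau> where "\<tau> = elem i (gscale (- coeff ((\<sigma> \<circ> g) (gvar i)) \<alpha>) (monomial \<alpha>))"
  have \<sigma>g: "\<sigma> \<circ> g \<in> Gamma"
    using g(2) k by (simp add: Gamma_upper_iff)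
  have "g \<circ> \<tau> \<in> generated (elems (\<lambda>i \<alpha>. k \<le> card \<alpha>))"
    unfolding \<tau>_def using g(1) \<alpha> by (intro generated_snoc elemsI)
  moreover have "\<sigma> \<circ> g \<circ> \<tau> \<in> Gamma_upper k"
    unfolding \<tau>_def using k g(2) \<alpha> by (rule Gamma_upper_comp_elem)
  moreover have "coeff ((\<sigma> \<circ> g \<circ> \<tau>) (gvar j)) \<gamma> = 0" if j: "(j, \<gamma>) \<in> insert x S" for j \<gamma>
  proof -
    have "card \<gamma> \<le> card \<alpha>"
      using j insert.hyps(2)[of "(j, \<gamma>)"] unfolding x by auto
    then have "coeff ((\<sigma> \<circ> g \<circ> \<tau>) (gvar j)) \<gamma> = coeff ((\<sigma> \<circ> g) (gvar j)) \<gamma>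
        + (if j = i \<and> \<gamma> = \<alpha> then - coeff ((\<sigma> \<circ> g) (gvar i)) \<alpha> else 0)"
      unfolding \<tau>_def by (rule coeff_comp_elem[OF \<sigma>g])
    then show ?thesis
      using j g(3)[of j \<gamma>] unfolding x by (auto simp del: o_apply split: if_splits)
  qed
  ultimately show ?case
    unfolding comp_assoc by (intro bexI[of _ "g \<circ> \<tau>"] conjI ballI case_prodI2) (simp only:)+
qed

text \<open>Clear every coefficient that \<sigma>(x_i) - x_i may have. The result fixes all
  generators and is the identity, so \<sigma> is the inverse of the word used.\<close>

lemma Gamma_upper_generated:
  assumes k: "odd k" "3 \<le> k" and \<sigma>: "\<sigma> \<in> Gamma_upper k"
  shows "\<sigma> \<in> generated (elems (\<lambda>i \<alpha>. k \<le> card \<alpha>))"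
proof -
  let ?S = "{(i :: 'b, \<alpha>). odd (card \<alpha>) \<and> k \<le> card \<alpha>}"
  have "\<exists>g\<in>generated (elems (\<lambda>i \<alpha>. k \<le> card \<alpha>)). \<sigma> \<circ> g \<in> Gamma_upper k
    \<and> (\<forall>(i, \<alpha>)\<in>?S. coeff ((\<sigma> \<circ> g) (gvar i)) \<alpha> = 0)"
    using k \<sigma> by (intro Gamma_upper_clear) auto
  then obtain g where g: "g \<in> generated (elems (\<lambda>i \<alpha>. k \<le> card \<alpha>))" "\<sigma> \<circ> g \<in> Gamma_upper k"
    "\<And>i \<alpha>. odd (card \<alpha>) \<Longrightarrow> k \<le> card \<alpha> \<Longrightarrow> coeff ((\<sigma> \<circ> g) (gvar i)) \<alpha> = 0"
    by fast
  have \<sigma>g: "\<sigma> \<circ> g \<in> Gamma" and *: "(\<sigma> \<circ> g) (gvar i) - gvar i \<in> filt k" for i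
    using g(2) k by (simp_all add: Gamma_upper_iff)
  have "(\<sigma> \<circ> g) (gvar i) - gvar i = 0" for i
  proof (rule grassmann_eqI)
    fix \<alpha>
    show "coeff ((\<sigma> \<circ> g) (gvar i) - gvar i) \<alpha> = coeff 0 \<alpha>"
    proof (cases "odd (card \<alpha>) \<and> k \<le> card \<alpha>")
      case True
      \<comment> \<open>As k is at least 3, x_i itself has no coefficient in this degree, so the
        cleared one is all there is.\<close>
      then show ?thesis
        using g(3)[of \<alpha> i] k by auto
    next
      case False
      then show ?thesis
        using *[of i] k(1) unfolding mem_filt by fastforce
    qed
  qed
  then have "\<sigma> \<circ> g = id"
    using Gamma_hom[OF \<sigma>g] Gamma_hom[OF id_Gamma] by (intro grassmann_hom_eqI) auto
  moreover obtain h where "h \<in> generated (elems (\<lambda>i \<alpha>. k \<le> card \<alpha>))" "g \<circ> h = id"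
    using generated_inverse[OF elems_inverse g(1)] by blast
  ultimately show ?thesis
    by (metis comp_assoc comp_id id_comp)
qed

lemma Gamma_generated: "\<sigma> \<in> Gamma \<Longrightarrow> \<sigma> \<in> generated (elems (\<lambda>i \<alpha>. 3 \<le> card \<alpha>))"
  by (rule Gamma_upper_generated) (auto simp: Gamma_upper_iff Gamma_iff)

section \<open>Filtration level and top coefficient of the Jacobian\<close>

section \<open>Values of the Jacobian\<close>

lemma filt_one_mult:
  assumes "even d" "a - 1 \<in> filt d" "b - 1 \<in> filt d"
  shows "a * b - 1 \<in> filt d"
proof -
  have "(a - 1) * (b - 1) \<in> filt d"
    using filt_mult[OF assms(2,3)] by (rule filt_mono) (use assms in auto)
  moreover have "a * b - 1 = (a - 1) * (b - 1) + (a - 1) + (b - 1)"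
    by (simp add: algebra_simps)
  ultimately show ?thesis
    using assms by (simp only:) (intro filt_add)
qed

lemma jacobian_id: "jacobian id = 1"
proof -
  \<comment> \<open>The identity is the substitution with u = 0, so \<open>jacobian_elem\<close>
    evaluates its determinant.\<close>
  have "elem undefined 0 = (id :: ('a, 'b) grassmann \<Rightarrow> _)"
    by (auto simp: elem_def)
  then show ?thesis
    using jacobian_elem[of undefined "0 :: ('a, 'b) grassmann"] by (simp add: elementary_def)
qed

text \<open>The set 1 + \<open>filt k\<close> is closed under products and stable under the group,
  so by the chain rule only generators matter, and differentiating a monomial of degree at least k +
  1 leaves degree at least k.\<close>

lemma jacobian_Gamma_upper:
  assumes k: "even k" "2 \<le> k" and \<sigma>: "\<sigma> \<in> Gamma_upper (Suc k)"
  shows "jacobian \<sigma> - 1 \<in> filt k"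
proof -
  have "\<sigma> \<in> generated (elems (\<lambda>i \<alpha>. Suc k \<le> card \<alpha>))"
    using assms by (intro Gamma_upper_generated) auto
  then show ?thesis
  proof induction
    case generated_id
    show ?case unfolding jacobian_id by simp
  next
    case (generated_snoc g \<tau>)
    from generated_snoc.hyps(2) obtain i c \<alpha>
      where \<tau>: "\<tau> = elem i (gscale c (monomial \<alpha>))" "Suc k \<le> card \<alpha>" "odd (card \<alpha>)" "3 \<le> card \<alpha>"
        "elementary i (gscale c (monomial \<alpha>))"
      by (rule elemsE)
    have g: "g \<in> Gamma"
      using generated_snoc.hyps by (intro generated_elems_Gamma)
    interpret grassmann_hom g using g by (rule Gamma_hom)
    have "gscale c (monomial \<alpha>) \<in> filt (Suc k)"
      using \<tau> k by (intro filt_gscale) (auto simp: mem_filt)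
    then have "jacobian \<tau> - 1 \<in> filt k"
      unfolding \<tau>(1) jacobian_elem[OF \<tau>(5)] by (simp add: filt_skew_partial)
    then have "g (jacobian \<tau> - 1) \<in> filt k"
      by (rule Gamma_filt[OF g])
    then have "g (jacobian \<tau>) - 1 \<in> filt k"
      by (simp add: diff)
    then have "g (jacobian \<tau>) * jacobian g - 1 \<in> filt k"
      using k(1) generated_snoc.IH by (intro filt_one_mult)
    then show ?case
      unfolding jacobian_comp[OF g elems_Gamma[OF generated_snoc.hyps(2)]] .
  qed
qed

text \<open>The top coefficient is the Berezin integral and \<open>v\<close> the inverse Jacobian.
  Stated with an existential, \<open>v\<close> can be built factor by factor along a word in the
  elementary automorphisms.\<close>

lemma berezin_change_of_variables:
  assumes "\<sigma> \<in> Gamma"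
  shows "\<exists>v. v * jacobian \<sigma> = 1 \<and> (\<forall>f. coeff (\<sigma> f * v) UNIV = coeff f UNIV)"
  using Gamma_generated[OF assms]
proof induction
  case generated_id
  show ?case
    unfolding jacobian_id by (intro exI[of _ 1]) simp
next
  case (generated_snoc g \<tau>)
  then obtain v where v: "v * jacobian g = 1" "\<And>f. coeff (g f * v) UNIV = coeff f UNIV"
    by blast
  obtain i u where \<tau>: "\<tau> = elem i u" "elementary i u"
    by (rule elemsE[OF generated_snoc.hyps(2)])
  have g: "g \<in> Gamma"
    using generated_snoc.hyps by (intro generated_elems_Gamma)
  interpret grassmann_hom g using g by (rule Gamma_hom)
  \<comment> \<open>The inverse of J(\<tau>) = 1 + du/dx_i, as du/dx_i has square zero. By the chain
    rule the witness for the longer word is \<open>g ?w * v\<close>.\<close>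
  let ?w = "1 - skew_partial i u"
  have w: "?w * jacobian \<tau> = 1"
    unfolding \<tau>(1) jacobian_elem[OF \<tau>(2)] by (simp add: algebra_simps elementary_partial_square[OF \<tau>(2)])
  have "jacobian \<tau> \<in> filt 0"
    unfolding \<tau>(1) jacobian_elem[OF \<tau>(2)] by (intro filt_add elementary_partial_even[OF \<tau>(2)]) simp
  then have "g (jacobian \<tau>) * v = v * g (jacobian \<tau>)"
    by (intro even_central Gamma_filt[OF g])
  then have "g ?w * v * (g (jacobian \<tau>) * jacobian g) = g (?w * jacobian \<tau>) * (v * jacobian g)"
    by (simp only: hom_mult mult.assoc) (metis mult.assoc)
  then have "g ?w * v * jacobian (g \<circ> \<tau>) = 1"
    by (simp only: w v hom_1 mult_1_left jacobian_comp[OF g elems_Gamma[OF generated_snoc.hyps(2)]])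
  moreover have "coeff ((g \<circ> \<tau>) f * (g ?w * v)) UNIV = coeff f UNIV" for f
  proof -
    \<comment> \<open>The induction hypothesis for \<open>\<tau> f * ?w\<close> removes
      \<open>g\<close>, and the elementary case removes \<tau>.\<close>
    have "(g \<circ> \<tau>) f * (g ?w * v) = g (\<tau> f * ?w) * v"
      by (simp only: hom_mult comp_apply mult.assoc)
    then show ?thesis
      by (simp only: v(2)) (simp only: \<tau>(1) elem_berezin[OF \<tau>(2)])
  qed
  ultimately show ?case
    by blast
qed

text \<open>If J = 1 + t with \<open>t\<close> a multiple of the top monomial, the inverse is 1 - t.
  Change of variables for the constant 1 compares the top coefficients of 1 - t and 1, which forces
  t = 0.\<close>

lemma jacobian_top_eq_1:
  fixes \<sigma> :: "('a::comm_ring_1, 'n::{finite,linorder}) grassmann \<Rightarrow> ('a, 'n) grassmann"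
  assumes "\<sigma> \<in> Gamma" and top: "\<And>\<gamma>. \<gamma> \<noteq> UNIV \<Longrightarrow> coeff (jacobian \<sigma> - 1) \<gamma> = 0"
  shows "jacobian \<sigma> = 1"
proof -
  interpret grassmann_hom \<sigma> using assms(1) by (rule Gamma_hom)
  define t where "t = jacobian \<sigma> - 1"
  have J: "jacobian \<sigma> = 1 + t"
    by (simp add: t_def)
  have t_top: "coeff t \<gamma> = 0" if "\<gamma> \<noteq> UNIV" for \<gamma>
    using top[OF that] by (simp only: t_def)
  have "t * t = 0"
  proof (rule grassmann_eqI)
    fix \<gamma> :: "'n set"
    \<comment> \<open>Complementary index sets cannot both be the full set, so each term of t * t
      has a vanishing factor.\<close>
    have "\<alpha> \<noteq> UNIV \<or> \<gamma> - \<alpha> \<noteq> UNIV" for \<alpha>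
      by auto
    then have "coeff t \<alpha> * coeff t (\<gamma> - \<alpha>) = 0" for \<alpha>
      by (metis t_top mult_zero_left mult_zero_right)
    then show "coeff (t * t) \<gamma> = coeff 0 \<gamma>"
      by (simp add: times_grassmann.rep_eq mult.assoc)
  qed
  obtain v where v: "v * (1 + t) = 1" "\<And>f. coeff (\<sigma> f * v) UNIV = coeff f UNIV"
    using berezin_change_of_variables[OF assms(1)] J by metis
  \<comment> \<open>Multiplying by 1 = (1 + t)(1 - t) identifies \<open>v\<close> with 1 -
    t.\<close>
  have "v = v * ((1 + t) * (1 - t))"
    by (simp add: algebra_simps \<open>t * t = 0\<close>)
  also have "\<dots> = 1 - t"
    by (simp add: v(1) flip: mult.assoc)
  finally have "coeff (\<sigma> 1 * (1 - t)) UNIV = coeff (1 :: ('a, 'n) grassmann) UNIV"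
    using v(2) by metis
  then have "coeff t UNIV = 0"
    by simp
  with t_top have "t = 0"
    by (intro grassmann_eqI) (metis zero_grassmann.rep_eq)
  then show ?thesis
    by (simp add: J)
qed

section \<open>Triangular substitutions and their membership in \<open>Phi'_upper\<close>\<close>

section \<open>Triangular automorphisms\<close>

text \<open>With \<open>i\<close> in \<alpha> the substitution multiplies x_i by 1 + c x^(\<alpha> -
  {i}) up to sign. The second condition makes \<open>i\<close> the largest index missing from
  \<alpha> - {i}, as in the spans A_i.\<close>

definition triangular_elems ::
    "nat \<Rightarrow> (('a::comm_ring_1, 'n::{finite,linorder}) grassmann \<Rightarrow> ('a, 'n) grassmann) set" where
  "triangular_elems k = elems (\<lambda>i \<alpha>. i \<in> \<alpha> \<and> {i<..} \<subseteq> \<alpha> \<and> k \<le> card \<alpha>)"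

lemma coeff_mult_containing:
  assumes "\<And>\<gamma>. coeff a \<gamma> \<noteq> 0 \<Longrightarrow> i \<in> \<gamma>" "coeff (a * b) \<gamma> \<noteq> 0"
  shows "i \<in> \<gamma>"
proof -
  obtain \<alpha> where "\<alpha> \<subseteq> \<gamma>" "koszul_sign \<alpha> (\<gamma> - \<alpha>) * coeff a \<alpha> * coeff b (\<gamma> - \<alpha>) \<noteq> 0"
    using assms(2) unfolding times_grassmann.rep_eq by (meson PowD sum.not_neutral_contains_not_neutral)
  moreover from this have "coeff a \<alpha> \<noteq> 0"
    by auto
  ultimately show ?thesis
    using assms(1) by blast
qed

text \<open>Appending a triangular substitution in x_l adds g(u) to the image of x_l. This is
  divisible by g(x_l), all of whose terms contain x_l, and in the lowest degree \<open>k\<close> it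
  agrees with \<open>u\<close>, whose monomial satisfies the tail condition.\<close>

lemma triangular_coeff:
  assumes k: "odd k" "3 \<le> k" and "g \<in> generated (triangular_elems k)"
  shows "coeff (g (gvar i) - gvar i) \<gamma> \<noteq> 0
    \<Longrightarrow> i \<in> \<gamma> \<and> odd (card \<gamma>) \<and> k \<le> card \<gamma> \<and> (card \<gamma> = k \<longrightarrow> {i<..} \<subseteq> \<gamma>)"
  using assms(3)
proof (induction arbitrary: i \<gamma>)
  case generated_id
  then show ?case by simp
next
  case (generated_snoc g \<tau>)
  obtain l c \<alpha> where \<tau>: "\<tau> = elem l (gscale c (monomial \<alpha>))" "l \<in> \<alpha> \<and> {l<..} \<subseteq> \<alpha> \<and> k \<le> card \<alpha>" "odd (card \<alpha>)"
    using generated_snoc.hyps(2) unfolding triangular_elems_def by (rule elemsE)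
  let ?u = "gscale c (monomial \<alpha>)"
  have g: "g \<in> Gamma"
    using generated_snoc.hyps(1) unfolding triangular_elems_def by (rule generated_elems_Gamma)
  interpret grassmann_hom g using g by (rule Gamma_hom)
  have split: "(g \<circ> \<tau>) (gvar i) - gvar i = (g (gvar i) - gvar i) + (if i = l then g ?u else 0)"
    unfolding \<tau>(1) comp_elem_gvar[OF g] by simp
  show ?case
  proof (cases "coeff (g (gvar i) - gvar i) \<gamma> = 0")
    case False
    then show ?thesis by (rule generated_snoc.IH)
  next
    case True
    then have i: "i = l" and nz: "coeff (g ?u) \<gamma> \<noteq> 0"
      using generated_snoc.prems unfolding split by (auto split: if_splits)
    have u: "?u \<in> filt (card \<alpha>)"
      by (intro filt_gscale filt_monomial refl)
    have card: "card \<alpha> \<le> card \<gamma>" "odd (card \<gamma>)"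
      using Gamma_filt[OF g u] nz \<tau>(3) unfolding mem_filt by auto
    have "g (gvar l) = gvar l + (g (gvar l) - gvar l)"
      by simp
    then have "coeff (g (gvar l)) \<delta> \<noteq> 0 \<Longrightarrow> l \<in> \<delta>" for \<delta>
      using generated_snoc.IH[of l \<delta>] by (cases "\<delta> = {l}") auto
    \<comment> \<open>Splitting off x_l shows that g(u) has the factor g(x_l).\<close>
    moreover have "monomial \<alpha> = gvar l * gscale (koszul_sign {l} (\<alpha> - {l})) (monomial (\<alpha> - {l}) :: ('a, 'b) grassmann)"
      using \<tau>(2) by (simp add: gscale_mult_right monomial_mult insert_absorb)
    then have "g ?u = g (gvar l) * g (gscale (c * koszul_sign {l} (\<alpha> - {l})) (monomial (\<alpha> - {l})))"
      by (simp add: hom_mult scale gscale_mult_right)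
    ultimately have "l \<in> \<gamma>"
      using nz coeff_mult_containing[of "g (gvar l)" l] by metis
    moreover have "{l<..} \<subseteq> \<gamma>" if "card \<gamma> = k"
    proof -
      \<comment> \<open>Degree \<open>k\<close> is at most |\<alpha>|, below the degree |\<alpha>| +
        2 where g(u) - u begins.\<close>
      have "coeff (g ?u - ?u) \<gamma> = 0"
        using Gamma_filt_diff[OF g u] by (rule coeff_filt_eq_0) (use that \<tau>(2) in simp)
      then have "\<gamma> = \<alpha>"
        using nz by (auto split: if_splits)
      then show ?thesis
        using \<tau>(2) by simp
    qed
    ultimately show ?thesis
      using card \<tau>(2) i by auto
  qed
qed

text \<open>Differentiate x_i t = 0. This divides \<open>t\<close> by x_i and thereby produces the
  factors c_i.\<close>

lemma gvar_mult_skew_partial: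
  assumes "\<And>\<gamma>. coeff t \<gamma> \<noteq> 0 \<Longrightarrow> i \<in> \<gamma>"
  shows "gvar i * skew_partial i t = t"
proof -
  have "gvar i * t = 0"
  proof (rule grassmann_eqI)
    fix \<gamma>
    have "koszul_sign \<alpha> (\<gamma> - \<alpha>) * coeff (gvar i) \<alpha> * coeff t (\<gamma> - \<alpha>) = 0" for \<alpha>
      using assms[of "\<gamma> - \<alpha>"] by (cases "coeff t (\<gamma> - \<alpha>) = 0") auto
    then show "coeff (gvar i * t) \<gamma> = coeff 0 \<gamma>"
      unfolding times_grassmann.rep_eq by simp
  qed
  then have "skew_partial i (gvar i) * t - gvar i * skew_partial i t = 0"
    by (simp flip: skew_partial_mult_odd[OF filt_gvar])
  then show ?thesis
    by (simp add: skew_partial_gvar)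
qed

text \<open>A monomial without x_i is a product of the other generators, so it lies in every
  subalgebra of the intersection.\<close>

lemma subalgebra_genI:
  fixes a :: "('a::comm_ring_1, 'n::{finite,linorder}) grassmann"
  assumes "\<And>\<gamma>. coeff a \<gamma> \<noteq> 0 \<Longrightarrow> i \<notin> \<gamma>"
  shows "a \<in> subalgebra_gen {gvar j | j. j \<noteq> i}"
  unfolding subalgebra_gen_def
proof (intro InterI)
  fix B :: "('a, 'n) grassmann set"
  assume "B \<in> {B. {gvar j | j. j \<noteq> i} \<subseteq> B \<and> grassmann.subspace B \<and> 1 \<in> B \<and> (\<forall>a\<in>B. \<forall>b\<in>B. a * b \<in> B)}"
  then have B: "\<And>j. j \<noteq> i \<Longrightarrow> gvar j \<in> B" "grassmann.subspace B" "1 \<in> B" "\<And>a b. a \<in> B \<Longrightarrow> b \<in> B \<Longrightarrow> a * b \<in> B"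
    by auto
  have "prod_list (map gvar xs) \<in> B" if "i \<notin> set xs" for xs
    using that
  proof (induction xs)
    case (Cons x xs)
    then have "gvar x \<in> B" "prod_list (map gvar xs) \<in> B"
      using B(1)[of x] by auto
    then show ?case
      using B(4) by simp
  qed (simp add: B(3))
  then have "monomial \<gamma> \<in> B" if "i \<notin> \<gamma>" for \<gamma>
    unfolding monomial_eq_prod_list[of \<gamma>] using that by simp
  then have "gscale (coeff a \<gamma>) (monomial \<gamma>) \<in> B" for \<gamma>
    using assms[of \<gamma>] grassmann.subspace_scale[OF B(2)] grassmann.subspace_0[OF B(2)]
    by (cases "coeff a \<gamma> = 0") auto
  then have "(\<Sum>\<gamma>\<in>UNIV. gscale (coeff a \<gamma>) (monomial \<gamma>)) \<in> B"
    by (intro grassmann.subspace_sum[OF B(2)])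
  then show "a \<in> B"
    by (simp only: grassmann_expansion [symmetric])
qed

lemma tail_spanI:
  assumes "\<And>\<gamma>. coeff a \<gamma> \<noteq> 0 \<Longrightarrow> card \<gamma> = d \<and> i \<notin> \<gamma> \<and> {i<..} \<subseteq> \<gamma>"
  shows "a \<in> tail_span d i"
proof -
  have "gscale (coeff a \<gamma>) (monomial \<gamma>) \<in> tail_span d i" for \<gamma>
  proof (cases "coeff a \<gamma> = 0")
    case True
    then show ?thesis
      unfolding tail_span_def by (simp add: grassmann.span_zero)
  next
    case False
    then show ?thesis
      unfolding tail_span_def using assms[OF False] by (intro grassmann.span_scale grassmann.span_base) blast
  qed
  then have "(\<Sum>\<gamma>\<in>UNIV. gscale (coeff a \<gamma>) (monomial \<gamma>)) \<in> tail_span d i"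
    unfolding tail_span_def by (intro grassmann.span_sum)
  then show ?thesis
    by (simp only: grassmann_expansion [symmetric])
qed

text \<open>All terms of g(x_i) - x_i contain x_i and can be divided by it. The quotient loses one
  degree, so its component of degree k - 1 inherits the tail condition known in degree
  \<open>k\<close>.\<close>

lemma triangular_Phi':
  assumes k: "odd k" "3 \<le> k" and g: "g \<in> generated (triangular_elems k)"
  shows "g \<in> Phi'_upper k"
proof -
  have g\<Gamma>: "g \<in> Gamma"
    using g unfolding triangular_elems_def by (rule generated_elems_Gamma)
  note coeffs = triangular_coeff[OF k g]
  define c where "c = (\<lambda>i. skew_partial i (g (gvar i) - gvar i))"
  have t: "g (gvar i) - gvar i \<in> filt k" for i
    unfolding mem_filt using coeffs[of i] k(1) by simp
  have upper: "g \<in> Gamma_upper k"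
    using g\<Gamma> t k by (simp add: Gamma_upper_iff)
  have "gvar i * c i = g (gvar i) - gvar i" for i
    unfolding c_def using coeffs by (intro gvar_mult_skew_partial) blast
  then have "g (gvar i) = gvar i * (1 + c i)" for i
    by (simp add: distrib_left)
  moreover have c_coeff: "i \<notin> \<gamma> \<and> coeff (g (gvar i) - gvar i) (insert i \<gamma>) \<noteq> 0" if "coeff (c i) \<gamma> \<noteq> 0" for i \<gamma>
    using that unfolding c_def coeff_skew_partial by (metis mult_zero_right)
  have "c i \<in> subalgebra_gen {gvar j | j. j \<noteq> i}" for i
    using c_coeff by (intro subalgebra_genI) blast
  moreover have "c i \<in> filt (k - 1)" for i
    unfolding c_def using t[of i] k by (intro filt_skew_partial) simp
  then have "c i \<in> pos_even_part" for i
    using k unfolding filt_def graded_part_def by fastforce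
  ultimately have Phi: "Phi_coeffs g c"
    unfolding Phi_coeffs_def by blast
  have "hom_component (k - 1) (c i) \<in> tail_span (k - 1) i" for i
  proof (rule tail_spanI)
    fix \<gamma> assume "coeff (hom_component (k - 1) (c i)) \<gamma> \<noteq> 0"
    then have \<gamma>: "card \<gamma> = k - 1" "coeff (c i) \<gamma> \<noteq> 0"
      by (auto simp: hom_component.rep_eq split: if_splits)
    then have i: "i \<notin> \<gamma>" "coeff (g (gvar i) - gvar i) (insert i \<gamma>) \<noteq> 0"
      using c_coeff by auto
    then have "card (insert i \<gamma>) = k"
      using \<gamma>(1) k by simp
    then have "{i<..} \<subseteq> insert i \<gamma>"
      using coeffs[OF i(2)] by simp
    then show "card \<gamma> = k - 1 \<and> i \<notin> \<gamma> \<and> {i<..} \<subseteq> \<gamma>"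
      using \<gamma>(1) i(1) by auto
  qed
  with Phi upper g\<Gamma> show ?thesis
    unfolding Phi'_upper_def Phi_upper_def Phi_def by blast
qed

section \<open>Clearing the Jacobian by triangular factors on the left\<close>

text \<open>Every \<open>\<beta> \<noteq> UNIV\<close> is \<open>\<alpha> - {i}\<close> for a triangular pair \<open>(i, \<alpha>)\<close>, with \<open>i\<close> the largest index
  outside \<open>\<beta>\<close>.\<close>

lemma jacobian_clear_coeff:
  fixes \<sigma> :: "('a::comm_ring_1, 'n::{finite,linorder}) grassmann \<Rightarrow> ('a, 'n) grassmann"
  assumes k: "even k" "2 \<le> k" and \<sigma>: "\<sigma> \<in> Gamma" "jacobian \<sigma> - 1 \<in> filt k"
    and \<beta>: "even (card \<beta>)" "k \<le> card \<beta>" "\<beta> \<noteq> UNIV"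
  shows "\<exists>\<tau>\<in>triangular_elems (Suc k). jacobian (\<tau> \<circ> \<sigma>) - 1 \<in> filt k \<and> coeff (jacobian (\<tau> \<circ> \<sigma>)) \<beta> = 0
    \<and> (\<forall>\<gamma>. \<gamma> \<noteq> \<beta> \<longrightarrow> card \<gamma> \<le> card \<beta> \<longrightarrow> coeff (jacobian (\<tau> \<circ> \<sigma>)) \<gamma> = coeff (jacobian \<sigma>) \<gamma>)"
proof -
  define i where "i = Max (- \<beta>)"
  have "- \<beta> \<noteq> {}"
    using \<beta>(3) by auto
  then have i: "i \<notin> \<beta>" "{i<..} \<subseteq> \<beta>"
    unfolding i_def using Max_in[of "- \<beta>"] Max_ge[of "- \<beta>"] by (auto simp: not_le[symmetric] simp del: Max_less_iff)
  define b where "b = coeff (jacobian \<sigma>) \<beta>"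
  \<comment> \<open>The sign cancels the one produced by differentiation, so that du/dx_i is exactly
    -b x^\<beta>.\<close>
  define u where "u = gscale (- b * koszul_sign {i} \<beta>) (monomial (insert i \<beta>))"
  have card: "card (insert i \<beta>) = Suc (card \<beta>)"
    using i(1) by simp
  have u: "elementary i u"
    unfolding u_def using card \<beta> k by (intro elementary_monomial) auto
  have \<tau>: "elem i u \<in> triangular_elems (Suc k)"
    unfolding u_def triangular_elems_def using card \<beta> k i by (intro elemsI) auto
  interpret grassmann_hom "elem i u"
    using u by (rule elem_hom)
  define w where "w = skew_partial i u"
  have w: "w = gscale (- b) (monomial \<beta>)"
    unfolding w_def u_def using i(1) by (simp add: skew_partial.scale skew_partial.neg skew_partial_monomial mult.assoc)
  have w_filt: "w \<in> filt (card \<beta>)"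
    unfolding w by (intro filt_gscale filt_monomial refl)
  let ?J = "jacobian \<sigma>" and ?J' = "jacobian (elem i u \<circ> \<sigma>)"
  have J': "?J' = elem i u ?J * (1 + w)"
    unfolding jacobian_comp[OF elem_Gamma[OF u] \<sigma>(1)] jacobian_elem[OF u] w_def ..
  have "elem i u (?J - 1) \<in> filt k"
    by (rule Gamma_filt[OF elem_Gamma[OF u] \<sigma>(2)])
  moreover have "(1 + w) - 1 \<in> filt k"
    using w_filt by (simp add: filt_mono \<beta> k)
  ultimately have J'_filt: "?J' - 1 \<in> filt k"
    unfolding J' using k(1) by (intro filt_one_mult) (simp_all add: diff)
  have "u \<in> filt (Suc (card \<beta>))"
    unfolding u_def using card by (intro filt_gscale filt_monomial) simp
  moreover have J_even: "?J \<in> filt 0"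
    using filt_add[OF filt_mono[OF \<sigma>(2)] filt_1] k by simp
  \<comment> \<open>The Jacobian is even, so its derivative is odd and has degree at least 1;
    together with \<open>u\<close> this is two degrees above \<beta>.\<close>
  ultimately have "u * skew_partial i ?J \<in> filt (Suc (card \<beta>) + 1)"
    by (intro filt_mult filt_skew_partial_0)
  moreover have "1 + w \<in> filt 0"
    using w_filt by (intro filt_add filt_1) (rule filt_mono, use \<beta> in auto)
  ultimately have 1: "u * skew_partial i ?J * (1 + w) \<in> filt (Suc (card \<beta>) + 1 + 0)"
    by (rule filt_mult)
  have 2: "(?J - 1) * w \<in> filt (k + card \<beta>)"
    by (rule filt_mult[OF \<sigma>(2) w_filt])
  \<comment> \<open>Besides J itself only \<open>w\<close> reaches degree |\<beta>|: the third
    summand starts at k + |\<beta>| and the last at |\<beta>| + 2.\<close>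
  have eq: "?J' = ?J + w + (?J - 1) * w + u * skew_partial i ?J * (1 + w)"
    unfolding J' elem_def by (simp add: algebra_simps)
  have coeff: "coeff ?J' \<gamma> = coeff ?J \<gamma> + (if \<gamma> = \<beta> then - b else 0)" if "card \<gamma> \<le> card \<beta>" for \<gamma>
  proof -
    have "coeff ((?J - 1) * w) \<gamma> = 0"
      using 2 by (rule coeff_filt_eq_0) (use that k in linarith)
    moreover have "coeff (u * skew_partial i ?J * (1 + w)) \<gamma> = 0"
      using 1 by (rule coeff_filt_eq_0) (use that in linarith)
    moreover have "coeff w \<gamma> = (if \<gamma> = \<beta> then - b else 0)"
      unfolding w by simp
    ultimately show ?thesis
      unfolding eq plus_grassmann.rep_eq by (simp only: add_0_right)
  qed
  have "coeff ?J' \<beta> = 0"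
    using coeff[of \<beta>] by (simp only: b_def) simp
  moreover have "coeff ?J' \<gamma> = coeff ?J \<gamma>" if "\<gamma> \<noteq> \<beta>" "card \<gamma> \<le> card \<beta>" for \<gamma>
    using coeff[OF that(2)] that(1) by (simp only: if_False add_0_right)
  ultimately show ?thesis
    using \<tau> J'_filt by blast
qed

lemma generated_triangular_Gamma: "g \<in> generated (triangular_elems k) \<Longrightarrow> g \<in> Gamma"
  unfolding triangular_elems_def by (rule generated_elems_Gamma)

text \<open>Coefficients are cleared by increasing degree, so that a later correction does not
  disturb an earlier one. Each correction multiplies on the left, where its own Jacobian enters as a
  factor.\<close>

lemma jacobian_clear:
  fixes \<sigma> :: "('a::comm_ring_1, 'n::{finite,linorder}) grassmann \<Rightarrow> ('a, 'n) grassmann"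
  assumes k: "even k" "2 \<le> k" and \<sigma>: "\<sigma> \<in> Gamma" "jacobian \<sigma> - 1 \<in> filt k"
    and "finite S" "\<And>\<beta>. \<beta> \<in> S \<Longrightarrow> even (card \<beta>) \<and> k \<le> card \<beta> \<and> \<beta> \<noteq> UNIV"
  shows "\<exists>g\<in>generated (triangular_elems (Suc k)). jacobian (g \<circ> \<sigma>) - 1 \<in> filt k
    \<and> (\<forall>\<beta>\<in>S. coeff (jacobian (g \<circ> \<sigma>)) \<beta> = 0)"
  using assms(5,6)
proof (induction S rule: finite_ranking_induct[where f = card])
  case empty
  show ?case
    using \<sigma> by (intro bexI[of _ id] generated_id) (simp_all only: id_comp, simp)
next
  case (insert \<beta> S)
  have "\<exists>g\<in>generated (triangular_elems (Suc k)). jacobian (g \<circ> \<sigma>) - 1 \<in> filt k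
    \<and> (\<forall>\<beta>\<in>S. coeff (jacobian (g \<circ> \<sigma>)) \<beta> = 0)"
    using insert.prems by (intro insert.IH) blast
  then obtain g where g: "g \<in> generated (triangular_elems (Suc k))" "jacobian (g \<circ> \<sigma>) - 1 \<in> filt k"
    "\<forall>\<beta>\<in>S. coeff (jacobian (g \<circ> \<sigma>)) \<beta> = 0"
    by blast
  have "g \<circ> \<sigma> \<in> Gamma"
    using generated_triangular_Gamma[OF g(1)] \<sigma>(1) by (rule Gamma_comp)
  moreover have "even (card \<beta>)" "k \<le> card \<beta>" "\<beta> \<noteq> UNIV"
    using insert.prems[of \<beta>] by blast+
  ultimately obtain \<tau> where \<tau>: "\<tau> \<in> triangular_elems (Suc k)" "jacobian (\<tau> \<circ> (g \<circ> \<sigma>)) - 1 \<in> filt k"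
    "coeff (jacobian (\<tau> \<circ> (g \<circ> \<sigma>))) \<beta> = 0"
    "\<And>\<gamma>. \<gamma> \<noteq> \<beta> \<Longrightarrow> card \<gamma> \<le> card \<beta> \<Longrightarrow> coeff (jacobian (\<tau> \<circ> (g \<circ> \<sigma>))) \<gamma> = coeff (jacobian (g \<circ> \<sigma>)) \<gamma>"
    using jacobian_clear_coeff[OF k _ g(2)] by metis
  have "coeff (jacobian (\<tau> \<circ> (g \<circ> \<sigma>))) \<gamma> = 0" if "\<gamma> \<in> insert \<beta> S" for \<gamma>
  proof (cases "\<gamma> = \<beta>")
    case True
    then show ?thesis using \<tau>(3) by (simp only:)
  next
    case False
    then have "\<gamma> \<in> S"
      using that by blast
    then show ?thesis
      using \<tau>(4)[OF False insert.hyps(2)] g(3) by (simp only: ball_simps)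
  qed
  moreover have "\<tau> \<circ> g \<in> generated (triangular_elems (Suc k))"
    using generated_comp[OF generated_base[OF \<tau>(1)] g(1)] .
  ultimately show ?case
    using \<tau>(2) unfolding comp_assoc[symmetric] by blast
qed

text \<open>After all coefficients below the top degree are cleared, the top one vanishes by the
  Berezin argument, so \<open>g \<circ> \<sigma>\<close> has Jacobian 1; undoing \<open>g\<close>
  gives the factorization.\<close>

lemma Gamma_factorization:
  fixes \<sigma> :: "('a::comm_ring_1, 'n::{finite,linorder}) grassmann \<Rightarrow> ('a, 'n) grassmann"
  assumes k: "even k" "2 \<le> k" and \<sigma>: "\<sigma> \<in> Gamma" "jacobian \<sigma> - 1 \<in> filt k"
  shows "\<exists>h\<in>generated (triangular_elems (Suc k)). \<exists>\<rho>\<in>Sigma_jac. \<sigma> = h \<circ> \<rho>"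
proof -
  let ?S = "{\<beta> :: 'n set. even (card \<beta>) \<and> k \<le> card \<beta> \<and> \<beta> \<noteq> UNIV}"
  have "\<exists>g\<in>generated (triangular_elems (Suc k)). jacobian (g \<circ> \<sigma>) - 1 \<in> filt k
    \<and> (\<forall>\<beta>\<in>?S. coeff (jacobian (g \<circ> \<sigma>)) \<beta> = 0)"
    by (rule jacobian_clear[OF k \<sigma>]) simp_all
  then obtain g where g: "g \<in> generated (triangular_elems (Suc k))" "jacobian (g \<circ> \<sigma>) - 1 \<in> filt k"
    "\<forall>\<beta>\<in>?S. coeff (jacobian (g \<circ> \<sigma>)) \<beta> = 0"
    by blast
  have g\<sigma>: "g \<circ> \<sigma> \<in> Gamma"
    using generated_triangular_Gamma[OF g(1)] \<sigma>(1) by (rule Gamma_comp)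
  \<comment> \<open>A nonzero coefficient would sit in even degree at least \<open>k\<close>, where
    it was cleared; since k is at least 2, subtracting 1 does not touch it.\<close>
  have "coeff (jacobian (g \<circ> \<sigma>) - 1) \<gamma> = 0" if "\<gamma> \<noteq> UNIV" for \<gamma>
  proof (rule ccontr)
    assume nz: "coeff (jacobian (g \<circ> \<sigma>) - 1) \<gamma> \<noteq> 0"
    then have \<gamma>: "k \<le> card \<gamma>" "even (card \<gamma>)"
      using g(2) k(1) unfolding mem_filt by auto
    then have "coeff (jacobian (g \<circ> \<sigma>)) \<gamma> = 0"
      using g(3) that by blast
    moreover have "\<gamma> \<noteq> {}"
      using \<gamma>(1) k(2) by auto
    ultimately show False
      using nz by (simp only: minus_grassmann.rep_eq one_grassmann.rep_eq if_False diff_0_right simp_thms)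
  qed
  then have "jacobian (g \<circ> \<sigma>) = 1"
    by (rule jacobian_top_eq_1[OF g\<sigma>])
  then have "g \<circ> \<sigma> \<in> Sigma_jac"
    using g\<sigma> unfolding Sigma_jac_def by blast
  moreover obtain h where "h \<in> generated (triangular_elems (Suc k))" "h \<circ> g = id"
    using generated_inverse[OF elems_inverse] g(1) unfolding triangular_elems_def by blast
  moreover from this have "\<sigma> = h \<circ> (g \<circ> \<sigma>)"
    by (simp only: comp_assoc[symmetric] id_comp)
  ultimately show ?thesis
    by blast
qed

section \<open>The Jacobian ascents and the final equalities\<close>

lemma Gamma_lower_iff:
  "even k \<Longrightarrow> 2 \<le> k \<Longrightarrow> \<sigma> \<in> Gamma_lower k \<longleftrightarrow> \<sigma> \<in> Gamma \<and> jacobian \<sigma> - 1 \<in> filt k"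
  unfolding Gamma_lower_def by (simp add: even_units_level_iff)

text \<open>All four sets lie in one cycle of inclusions: the ascent goes into the smallest product
  by \<open>Gamma_factorization\<close>, the products increase, and the largest goes back into the
  ascent by the chain rule.\<close>

lemma Gamma_lower_factor:
  assumes k: "even k" "2 \<le> k"
  shows "Gamma_lower k = Gamma_upper (k + 1) \<circ>\<^sub>S
      (Sigma_jac :: (('a::comm_ring_1, 'b::{finite,linorder}) grassmann \<Rightarrow> _) set)"
    and "Gamma_upper (k + 1) \<circ>\<^sub>S Sigma_jac = Phi_upper (k + 1) \<circ>\<^sub>S (Sigma_jac :: (('a, 'b) grassmann \<Rightarrow> _) set)"
    and "Phi_upper (k + 1) \<circ>\<^sub>S Sigma_jac = Phi'_upper (k + 1) \<circ>\<^sub>S (Sigma_jac :: (('a, 'b) grassmann \<Rightarrow> _) set)"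
proof -
  have "Gamma_lower k \<subseteq> Phi'_upper (k + 1) \<circ>\<^sub>S (Sigma_jac :: (('a, 'b) grassmann \<Rightarrow> _) set)"
  proof
    fix \<sigma> :: "('a, 'b) grassmann \<Rightarrow> ('a, 'b) grassmann"
    assume "\<sigma> \<in> Gamma_lower k"
    then have "\<sigma> \<in> Gamma" "jacobian \<sigma> - 1 \<in> filt k"
      using k by (simp_all add: Gamma_lower_iff)
    then obtain h \<rho> where "h \<in> generated (triangular_elems (Suc k))" "\<rho> \<in> Sigma_jac" "\<sigma> = h \<circ> \<rho>"
      using Gamma_factorization[OF k] by blast
    moreover from this have "h \<in> Phi'_upper (k + 1)"
      using k by (intro triangular_Phi') auto
    ultimately show "\<sigma> \<in> Phi'_upper (k + 1) \<circ>\<^sub>S Sigma_jac"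
      unfolding set_comp_def by blast
  qed
  moreover have "Phi'_upper (k + 1) \<circ>\<^sub>S Sigma_jac \<subseteq> Phi_upper (k + 1) \<circ>\<^sub>S (Sigma_jac :: (('a, 'b) grassmann \<Rightarrow> _) set)"
    "Phi_upper (k + 1) \<circ>\<^sub>S Sigma_jac \<subseteq> Gamma_upper (k + 1) \<circ>\<^sub>S (Sigma_jac :: (('a, 'b) grassmann \<Rightarrow> _) set)"
    unfolding set_comp_def Phi'_upper_def Phi_upper_def by blast+
  moreover have "Gamma_upper (k + 1) \<circ>\<^sub>S Sigma_jac \<subseteq> (Gamma_lower k :: (('a, 'b) grassmann \<Rightarrow> _) set)"
  proof
    fix \<sigma> :: "('a, 'b) grassmann \<Rightarrow> ('a, 'b) grassmann"
    assume "\<sigma> \<in> Gamma_upper (k + 1) \<circ>\<^sub>S Sigma_jac"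
    then obtain a b where ab: "a \<in> Gamma_upper (k + 1)" "b \<in> Gamma" "jacobian b = 1" and \<sigma>: "\<sigma> = a \<circ> b"
      unfolding set_comp_def Sigma_jac_def by blast
    have a: "a \<in> Gamma"
      using ab(1) by (simp add: Gamma_upper_def)
    interpret grassmann_hom a using a by (rule Gamma_hom)
    have "jacobian a - 1 \<in> filt k"
      using k ab(1) by (intro jacobian_Gamma_upper) simp_all
    \<comment> \<open>The chain rule gives a(J(b)) J(a), and a(1) = 1.\<close>
    moreover have "jacobian \<sigma> = jacobian a"
      unfolding \<sigma> jacobian_comp[OF a ab(2)] by (simp add: ab(3))
    ultimately show "\<sigma> \<in> Gamma_lower k"
      using Gamma_comp[OF a ab(2)] k unfolding \<sigma>[symmetric] by (simp add: Gamma_lower_iff)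
  qed
  ultimately show "Gamma_lower k = Gamma_upper (k + 1) \<circ>\<^sub>S (Sigma_jac :: (('a, 'b) grassmann \<Rightarrow> _) set)"
    and "Gamma_upper (k + 1) \<circ>\<^sub>S Sigma_jac = Phi_upper (k + 1) \<circ>\<^sub>S (Sigma_jac :: (('a, 'b) grassmann \<Rightarrow> _) set)"
    and "Phi_upper (k + 1) \<circ>\<^sub>S Sigma_jac = Phi'_upper (k + 1) \<circ>\<^sub>S (Sigma_jac :: (('a, 'b) grassmann \<Rightarrow> _) set)"
    by blast+
qed

text \<open>At level at least n, J - 1 can only have a top coefficient, and
  \<open>jacobian_top_eq_1\<close> excludes it.\<close>

lemma Gamma_lower_top:
  assumes "even k" "2 \<le> k" "CARD('n) \<le> k"
  shows "Gamma_lower k = (Sigma_jac :: (('a::comm_ring_1, 'n::{finite,linorder}) grassmann \<Rightarrow> _) set)"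
proof (intro equalityI subsetI)
  fix \<sigma> :: "('a, 'n) grassmann \<Rightarrow> ('a, 'n) grassmann"
  assume "\<sigma> \<in> Gamma_lower k"
  then have \<sigma>: "\<sigma> \<in> Gamma" "jacobian \<sigma> - 1 \<in> filt k"
    using assms by (simp_all add: Gamma_lower_iff)
  have "coeff (jacobian \<sigma> - 1) \<gamma> = 0" if "\<gamma> \<noteq> UNIV" for \<gamma>
  proof (rule coeff_filt_eq_0[OF \<sigma>(2)])
    have "\<gamma> \<subset> UNIV"
      using that by blast
    then show "card \<gamma> < k"
      using assms(3) psubset_card_mono[of UNIV \<gamma>] by simp
  qed
  then have "jacobian \<sigma> = 1"
    by (rule jacobian_top_eq_1[OF \<sigma>(1)])
  with \<sigma>(1) show "\<sigma> \<in> Sigma_jac"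
    by (simp add: Sigma_jac_def)
next
  fix \<sigma> :: "('a, 'n) grassmann \<Rightarrow> ('a, 'n) grassmann"
  assume "\<sigma> \<in> Sigma_jac"
  then show "\<sigma> \<in> Gamma_lower k"
    using assms by (simp add: Gamma_lower_iff Sigma_jac_def)
qed

theorem theorem7p1:
  fixes n :: nat
  assumes "n = CARD('n::{finite,linorder})" and "n \<ge> 4"
  shows "(\<forall>s\<in>{1..(n - 1) div 2}.
        (Gamma_lower (2 * s) :: (('a::comm_ring_1, 'n) grassmann \<Rightarrow> ('a, 'n) grassmann) set)
          = Gamma_upper (2 * s + 1) \<circ>\<^sub>S Sigma_jac
      \<and> (Gamma_upper (2 * s + 1) \<circ>\<^sub>S Sigma_jac :: (('a, 'n) grassmann \<Rightarrow> ('a, 'n) grassmann) set)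
          = Phi_upper (2 * s + 1) \<circ>\<^sub>S Sigma_jac
      \<and> (Phi_upper (2 * s + 1) \<circ>\<^sub>S Sigma_jac :: (('a, 'n) grassmann \<Rightarrow> ('a, 'n) grassmann) set)
          = Phi'_upper (2 * s + 1) \<circ>\<^sub>S Sigma_jac)
    \<and> (even n \<longrightarrow>
        (Gamma_lower n :: (('a, 'n) grassmann \<Rightarrow> ('a, 'n) grassmann) set) = Gamma_lower (n + 2)
      \<and> (Gamma_lower (n + 2) :: (('a, 'n) grassmann \<Rightarrow> ('a, 'n) grassmann) set) = Sigma_jac)"
proof (intro conjI ballI impI)
  fix s assume "s \<in> {1..(n - 1) div 2}"
  then have s: "even (2 * s)" "2 \<le> 2 * s"
    by auto
  show "(Gamma_lower (2 * s) :: (('a, 'n) grassmann \<Rightarrow> ('a, 'n) grassmann) set)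
      = Gamma_upper (2 * s + 1) \<circ>\<^sub>S Sigma_jac"
    "(Gamma_upper (2 * s + 1) \<circ>\<^sub>S Sigma_jac :: (('a, 'n) grassmann \<Rightarrow> ('a, 'n) grassmann) set)
      = Phi_upper (2 * s + 1) \<circ>\<^sub>S Sigma_jac"
    "(Phi_upper (2 * s + 1) \<circ>\<^sub>S Sigma_jac :: (('a, 'n) grassmann \<Rightarrow> ('a, 'n) grassmann) set)
      = Phi'_upper (2 * s + 1) \<circ>\<^sub>S Sigma_jac"
    using s by (rule Gamma_lower_factor)+
next
  assume "even n"
  \<comment> \<open>Both levels, n and n + 2, are even and at least n, so each of the two ascents
    equals the Jacobian group.\<close>
  then have "(Gamma_lower n :: (('a, 'n) grassmann \<Rightarrow> ('a, 'n) grassmann) set) = Sigma_jac"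
    "(Gamma_lower (n + 2) :: (('a, 'n) grassmann \<Rightarrow> ('a, 'n) grassmann) set) = Sigma_jac"
    using assms by (simp_all add: Gamma_lower_top)
  then show "(Gamma_lower n :: (('a, 'n) grassmann \<Rightarrow> ('a, 'n) grassmann) set) = Gamma_lower (n + 2)"
    "(Gamma_lower (n + 2) :: (('a, 'n) grassmann \<Rightarrow> ('a, 'n) grassmann) set) = Sigma_jac"
    by (simp_all only:)
qed

end
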